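(* Let $X$ be a Banach space over $\mathbb{K}=\mathbb{R}$ or $\mathbb{C}$. If $\mathcal{L}_{d,1}(^{2}X)=\mathcal{L}(^{2}X)$, i.e. if every continuous bilinear form on $X\times X$ is $1$-dominated, then $\cot X=2$.
   Context: $\cot X$ denotes the infimum of the $q\in[2,\infty]$ such that $X$ has cotype $q$. $\mathcal{L}(^{2}X)$ is the space of all continuous bilinear forms $A\colon X\times X\to\mathbb{K}$. For $r>0$, a sequence $(x_j)_{j=1}^\infty$ in $X$ is weakly $r$-summable if $\sup_{\varphi\in B_{X^{*}}}\left(\sum_{j=1}^\infty|\varphi(x_j)|^{r}\right)^{1/r}<\infty$, where $B_{X^{*}}$ is the closed unit ball of the dual $X^{*}$. A form $A\in\mathcal{L}(^{2}X)$ is $r$-dominated if $(A(x_j,y_j))_{j=1}^\infty\in\ell_{r/2}$ (i.e. $\sum_j|A(x_j,y_j)|^{r/2}<\infty$) whenever $(x_j)_{j=1}^\infty$ and $(y_j)_{j=1}^\infty$ are weakly $r$-summable in $X$. $\mathcal{L}_{d,r}(^{2}X)$ is the set of all $r$-dominated $A\in\mathcal{L}(^{2}X)$. *)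

theory Defs
  imports "HOL-Analysis.Analysis"
begin

text \<open>The library classes only provide real scalars.  A Banach space over a field \<open>'k\<close>
  is therefore a type of class \<open>banach\<close> with an explicit multiplication by \<open>'k\<close>-scalars that
  extends the real one and for which the given norm is homogeneous.\<close>

locale normed_scaling = vector_space smul
  for smul :: "'k::real_normed_field \<Rightarrow> 'a::real_normed_vector \<Rightarrow> 'a" +
  assumes smul_of_real: "smul (of_real t) x = t *\<^sub>R x"
    and norm_smul: "norm (smul c x) = norm c * norm x"

lemma normed_scaling_scaleR:
  "normed_scaling (scaleR :: real \<Rightarrow> 'a::real_normed_vector \<Rightarrow> 'a)"
  by unfold_locales (auto simp: algebra_simps)

definition dual_ball ::
    "('k::real_normed_field \<Rightarrow> 'a::real_normed_vector \<Rightarrow> 'a) \<Rightarrow> ('a \<Rightarrow> 'k) set" where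
  "dual_ball smul =
     {\<phi>. Vector_Spaces.linear smul (*) \<phi> \<and> bounded_linear \<phi> \<and> onorm \<phi> \<le> 1}"

definition cont_bilinear_forms ::
    "('k::real_normed_field \<Rightarrow> 'a::real_normed_vector \<Rightarrow> 'a) \<Rightarrow> ('a \<Rightarrow> 'a \<Rightarrow> 'k) set" where
  "cont_bilinear_forms smul =
     {A. (\<forall>y. Vector_Spaces.linear smul (*) (\<lambda>x. A x y)) \<and>
         (\<forall>x. Vector_Spaces.linear smul (*) (\<lambda>y. A x y)) \<and>
         continuous_on UNIV (\<lambda>(x, y). A x y)}"

text \<open>Summability is demanded separately because \<open>suminf\<close> is unspecified on divergent
  series.\<close>

definition weakly_summable ::
    "('k::real_normed_field \<Rightarrow> 'a::real_normed_vector \<Rightarrow> 'a) \<Rightarrow> real \<Rightarrow> (nat \<Rightarrow> 'a) \<Rightarrow> bool" where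
  "weakly_summable smul r x \<longleftrightarrow>
     (\<forall>\<phi>\<in>dual_ball smul. summable (\<lambda>j. norm (\<phi> (x j)) powr r)) \<and>
     bdd_above ((\<lambda>\<phi>. (\<Sum>j. norm (\<phi> (x j)) powr r) powr (1 / r)) ` dual_ball smul)"

definition dominated_forms ::
    "('k::real_normed_field \<Rightarrow> 'a::real_normed_vector \<Rightarrow> 'a) \<Rightarrow> real \<Rightarrow> ('a \<Rightarrow> 'a \<Rightarrow> 'k) set" where
  "dominated_forms smul r =
     {A \<in> cont_bilinear_forms smul.
        \<forall>x y. weakly_summable smul r x \<longrightarrow> weakly_summable smul r y \<longrightarrow>
          summable (\<lambda>j. norm (A (x j) (y j)) powr (r / 2))}"

text \<open>The quadratic mean of \<open>\<parallel>\<Sum>j<n. \<epsilon> j x\<^sub>j\<parallel>\<close> over independent uniform signs, i.e. the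
  \<open>L\<^sub>2\<close>-norm over \<open>[0, 1]\<close> of \<open>\<Sum>j<n. r\<^sub>j(t) x\<^sub>j\<close> with the Rademacher functions \<open>r\<^sub>j\<close>.\<close>

definition rademacher_mean :: "nat \<Rightarrow> (nat \<Rightarrow> 'a::real_normed_vector) \<Rightarrow> real" where
  "rademacher_mean n x =
     sqrt ((\<Sum>\<epsilon>\<in>{..<n} \<rightarrow>\<^sub>E {-1, 1::real}. (norm (\<Sum>j<n. \<epsilon> j *\<^sub>R x j))\<^sup>2) / 2 ^ n)"

text \<open>For \<open>q = \<infinity>\<close> the \<open>\<ell>\<^sub>q\<close>-norm on the left of the cotype inequality is a maximum.\<close>

definition has_cotype :: "ereal \<Rightarrow> 'a::real_normed_vector itself \<Rightarrow> bool" where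
  "has_cotype q X \<longleftrightarrow>
     (\<exists>C\<ge>0. \<forall>n. \<forall>x :: nat \<Rightarrow> 'a.
        if q = \<infinity> then \<forall>j<n. norm (x j) \<le> C * rademacher_mean n x
        else (\<Sum>j<n. norm (x j) powr real_of_ereal q) powr (1 / real_of_ereal q)
               \<le> C * rademacher_mean n x)"

definition cotype_index :: "'a::real_normed_vector itself \<Rightarrow> ereal" where
  "cotype_index X = Inf {q. 2 \<le> q \<and> has_cotype q X}"

end

theory Submission
  imports Defs "HOL-Library.Ramsey"
begin

text \<open>The hypothesis is used through one consequence, the Orlicz property: some \<open>K\<close> satisfies
  \<open>\<Sum>i<n. \<parallel>u\<^sub>i\<parallel>\<^sup>2 \<le> K w\<^sup>2\<close> whenever all signed sums of the \<open>u\<^sub>i\<close> have norm at most \<open>w\<close>.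
  Let \<open>x\<close> be weakly \<open>1\<close>-summable.  By Baire's theorem the sums
  \<open>\<Sum>j. \<bar>A(x\<^sub>j, x\<^sub>j)\<bar>\<^bsup>1/2\<^esup>\<close> are bounded by one number \<open>M\<close> for all forms \<open>A\<close> of norm at most \<open>1\<close>.
  Test this on \<open>A = \<Sum>j. \<epsilon>\<^sub>j a\<^sub>j \<phi>\<^sub>j \<otimes> \<phi>\<^sub>j\<close>, where \<open>\<phi>\<^sub>j\<close> norms \<open>x\<^sub>j\<close> and the weights \<open>a\<^sub>j \<ge> 0\<close>,
  proportional to \<open>\<parallel>x\<^sub>j\<parallel>\<^sup>2\<close>, have sum \<open>1\<close>.  On average over the signs \<open>\<epsilon>\<close>, the \<open>j\<close>-th term is at
  least of the order of \<open>(a\<^sub>j \<parallel>x\<^sub>j\<parallel>\<^sup>2)\<^bsup>1/2\<^esup>\<close>, whatever the other summands of \<open>A\<close> contribute, and so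
  \<open>\<Sum>j. \<parallel>x\<^sub>j\<parallel>\<^sup>2 \<le> 4 M\<^sup>2\<close>.  Glueing finite families together makes the constant uniform
  (\<open>dominated_imp_orlicz\<close>).

  The Orlicz property bounds signed sums in the supremum over signs, cotype in the mean over signs,
  and the first is in general the larger.  Ramsey's theorem bridges the gap.  Call a finite set of
  indices poor if the mean square of its signed sums is small compared with its cardinality; then
  some pattern of signs gives a small sum.  In a long sequence of vectors with norms bounded from
  below, if all subsets of size \<open>l\<close> are poor, Ramsey's theorem yields a long subsequence on which
  one pattern \<open>\<epsilon>\<close> gives a small sum for every subset of size \<open>l\<close>.  Split it into \<open>l\<close> consecutive
  cells of size \<open>l\<close>.  Changing the representative of each cell and subtracting shows that
  differences \<open>u\<^sub>i = x\<^sub>a - x\<^sub>b\<close> within the cells have small signed sums for every choice of signs, so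
  by the Orlicz property it is impossible that every cell contains a large difference.
  Hence in one cell all vectors are close to each other, and a
  functional that norms one of them shows that this cell was not poor.  This is
  \<open>large_rad_subset\<close>.

  Let \<open>D(n)\<close> be the optimal constant in \<open>\<Sum>j<n. \<parallel>y\<^sub>j\<parallel>\<^sup>2 \<le> D(n) \<cdot> (rademacher_mean n y)\<^sup>2\<close>.  Cut a
  sequence of length \<open>l m\<close> into blocks of size \<open>l\<close> that are not poor and consist of vectors of
  comparable norm, until only few vectors of each order of magnitude are left.  Applying \<open>D(m)\<close> to
  the signed block sums gives \<open>D(l m) \<le> C D(m) + O\<^sub>l(1)\<close> with \<open>C\<close> independent of \<open>l\<close>
  (\<open>cotype2_bound_times\<close>).  Since \<open>l\<close> is arbitrary, \<open>D(n) = O(n\<^sup>b)\<close> for every \<open>b > 0\<close>, and this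
  yields cotype \<open>q\<close> for every \<open>q > 2\<close>.\<close>

section \<open>Norming functionals\<close>

definition sublinear :: "('a::real_vector \<Rightarrow> real) \<Rightarrow> bool" where
  "sublinear p \<longleftrightarrow>
     (\<forall>x y. p (x + y) \<le> p x + p y) \<and> (\<forall>c x. c > 0 \<longrightarrow> p (c *\<^sub>R x) = c * p x)"

lemma sublinear_zero: "sublinear p \<Longrightarrow> p 0 = 0"
proof -
  assume "sublinear p"
  then have "p (2 *\<^sub>R 0) = 2 * p 0"
    unfolding sublinear_def by (metis zero_less_numeral)
  then show ?thesis by simp
qed

lemma sublinear_lower: "sublinear p \<Longrightarrow> - p (- x) \<le> p x"
  using sublinear_zero[of p] unfolding sublinear_def
  by (metis add.right_inverse minus_le_iff add.inverse_inverse diff_le_eq add.commute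
      diff_0 uminus_add_conv_diff le_diff_eq)

text \<open>Both constructions below, the infimum of a chain and the tilting of a functional, are infima of
  families in which the sublinearity inequalities hold up to passing to another member of the
  family.\<close>

lemma sublinear_INF:
  fixes Q :: "'i \<Rightarrow> 'a::real_vector \<Rightarrow> real"
  assumes I: "I \<noteq> {}" and low: "\<And>i x. i \<in> I \<Longrightarrow> L x \<le> Q i x"
    and add: "\<And>i j x y. \<lbrakk>i \<in> I; j \<in> I\<rbrakk> \<Longrightarrow> \<exists>k\<in>I. Q k (x + y) \<le> Q i x + Q j y"
    and scale: "\<And>i c x. \<lbrakk>i \<in> I; c > 0\<rbrakk> \<Longrightarrow> \<exists>k\<in>I. Q k (c *\<^sub>R x) \<le> c * Q i x"
  shows "sublinear (\<lambda>x. INF i\<in>I. Q i x)"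
proof -
  let ?u = "\<lambda>x. INF i\<in>I. Q i x"
  have bdd: "bdd_below ((\<lambda>i. Q i x) ` I)" for x
    using low by (auto intro!: bdd_belowI)
  have le: "?u x \<le> Q i x" if "i \<in> I" for i x
    using bdd that by (rule cINF_lower)
  have sub: "?u (x + y) \<le> ?u x + ?u y" for x y
  proof -
    have "?u (x + y) - Q j y \<le> ?u x" if j: "j \<in> I" for j
    proof (rule cINF_greatest[OF I])
      fix i assume "i \<in> I"
      then obtain k where "k \<in> I" "Q k (x + y) \<le> Q i x + Q j y" using add j by blast
      with le[of k "x + y"] show "?u (x + y) - Q j y \<le> Q i x" by simp
    qed
    then have "?u (x + y) - ?u x \<le> ?u y"
      by (intro cINF_greatest[OF I]) (simp add: algebra_simps)
    then show ?thesis by simp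
  qed
  have hom1: "?u (c *\<^sub>R x) \<le> c * ?u x" if c: "c > 0" for c x
  proof -
    have "?u (c *\<^sub>R x) / c \<le> ?u x"
    proof (rule cINF_greatest[OF I])
      fix i assume "i \<in> I"
      then obtain k where "k \<in> I" "Q k (c *\<^sub>R x) \<le> c * Q i x" using scale c by blast
      with le[of k "c *\<^sub>R x"] show "?u (c *\<^sub>R x) / c \<le> Q i x"
        using c by (simp add: pos_divide_le_eq mult.commute)
    qed
    then show ?thesis using c by (simp add: pos_divide_le_eq mult.commute)
  qed
  have hom: "?u (c *\<^sub>R x) = c * ?u x" if c: "c > 0" for c x
  proof (rule antisym[OF hom1[OF c]])
    have "?u ((1 / c) *\<^sub>R (c *\<^sub>R x)) \<le> (1 / c) * ?u (c *\<^sub>R x)"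
      using c by (intro hom1) simp
    then show "c * ?u x \<le> ?u (c *\<^sub>R x)"
      using c by (simp add: pos_le_divide_eq mult.commute)
  qed
  show ?thesis unfolding sublinear_def using sub hom by blast
qed

text \<open>The largest sublinear minorant of \<open>p\<close> with the value \<open>- p(y)\<close> at \<open>- y\<close>.  It is linear on the
  line spanned by \<open>y\<close>.\<close>

definition tilt :: "('a::real_vector \<Rightarrow> real) \<Rightarrow> 'a \<Rightarrow> 'a \<Rightarrow> real" where
  "tilt p y x = (INF t\<in>{0..}. p (x + t *\<^sub>R y) - t * p y)"

lemma
  assumes p: "sublinear p"
  shows sublinear_tilt: "sublinear (tilt p y)"
    and tilt_le: "t \<ge> 0 \<Longrightarrow> tilt p y x \<le> p (x + t *\<^sub>R y) - t * p y"
proof -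
  have sub: "p (u + v) \<le> p u + p v" for u v using p by (simp add: sublinear_def)
  have hom: "c \<ge> 0 \<Longrightarrow> p (c *\<^sub>R u) = c * p u" for c u
    using p sublinear_zero[OF p] by (cases "c = 0") (auto simp: sublinear_def)
  have low: "- p (- x) \<le> p (x + t *\<^sub>R y) - t * p y" if "t \<in> {0..}" for t x
    using sub[of "x + t *\<^sub>R y" "- x"] hom[of t y] that by simp
  have "sublinear (\<lambda>x. INF t\<in>{0..}. p (x + t *\<^sub>R y) - t * p y)"
  proof (rule sublinear_INF[where L = "\<lambda>x. - p (- x)"])
    show "\<exists>k\<in>{0..}. p (x + z + k *\<^sub>R y) - k * p y
            \<le> (p (x + t *\<^sub>R y) - t * p y) + (p (z + s *\<^sub>R y) - s * p y)"
      if "t \<in> {0..}" "s \<in> {0..}" for t s :: real and x z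
      using that sub[of "x + t *\<^sub>R y" "z + s *\<^sub>R y"]
      by (intro bexI[of _ "t + s"]) (auto simp: algebra_simps)
    show "\<exists>k\<in>{0..}. p (c *\<^sub>R x + k *\<^sub>R y) - k * p y \<le> c * (p (x + t *\<^sub>R y) - t * p y)"
      if "t \<in> {0..}" "c > 0" for t c :: real and x
      using that hom[of c "x + t *\<^sub>R y"]
      by (intro bexI[of _ "c * t"]) (auto simp: algebra_simps)
  qed (use low in auto)
  then show "sublinear (tilt p y)" by (simp add: tilt_def[abs_def])
  show "tilt p y x \<le> p (x + t *\<^sub>R y) - t * p y" if "t \<ge> 0"
    unfolding tilt_def using that low
    by (intro cINF_lower bdd_belowI[where m = "- p (- x)"]) auto
qed

text \<open>A minimal sublinear functional coincides with all its tilts, and \<open>tilt q y = q\<close> says that \<open>q\<close>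
  is superadditive in the direction \<open>y\<close>.\<close>

lemma sublinear_minimal_imp_linear:
  fixes q :: "'a::real_vector \<Rightarrow> real"
  assumes q: "sublinear q"
    and min: "\<And>p. \<lbrakk>sublinear p; \<And>x. p x \<le> q x\<rbrakk> \<Longrightarrow> p = q"
  shows "linear q"
proof -
  have "tilt q y = q" for y
    using sublinear_tilt[OF q] tilt_le[OF q, of 0] by (intro min) auto
  then have "q x + q y \<le> q (x + y)" for x y
    using tilt_le[OF q, of 1 y x] by simp
  then have add: "q (x + y) = q x + q y" for x y
    using q by (simp add: sublinear_def antisym)
  have neg: "q (- x) = - q x" for x
    using add[of x "- x"] sublinear_zero[OF q] by simp
  have hom: "q (c *\<^sub>R x) = c *\<^sub>R q x" for c x
  proof -
    consider "c = 0" | "c > 0" | "- c > 0" by linarith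
    then show ?thesis
    proof cases
      case 3
      then have "q ((- c) *\<^sub>R x) = - c * q x" using q unfolding sublinear_def by blast
      then show ?thesis using neg[of "c *\<^sub>R x"] by simp
    qed (use q sublinear_zero[OF q] in \<open>auto simp: sublinear_def\<close>)
  qed
  show ?thesis using add hom by (rule linearI)
qed

text \<open>The Hahn--Banach theorem in the form that is needed.  A minimal sublinear functional below the
  norm is linear; starting the descent at the norm tilted towards \<open>x0\<close> forces the value
  \<open>- \<parallel>x0\<parallel>\<close> at \<open>- x0\<close>.\<close>

lemma real_norming_functional:
  fixes x0 :: "'a::real_normed_vector"
  obtains f :: "'a \<Rightarrow> real" where "linear f" "\<And>x. \<bar>f x\<bar> \<le> norm x" "f x0 = norm x0"
proof -
  let ?r = "tilt norm x0"
  define P where "P = {p. sublinear p \<and> (\<forall>x. p x \<le> ?r x)}"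
  have nrm: "sublinear (norm :: 'a \<Rightarrow> real)"
    by (auto simp: sublinear_def norm_triangle_ineq)
  have r: "sublinear ?r" by (rule sublinear_tilt[OF nrm])
  have r_le: "?r x \<le> norm x" for x using tilt_le[OF nrm, of 0 x0 x] by simp
  have "\<exists>m\<in>P. \<forall>a\<in>P. (\<lambda>p q. \<forall>x. q x \<le> p x) m a \<longrightarrow> a = m"
  proof (rule predicate_Zorn)
    show "partial_order_on P (relation_of (\<lambda>p q. \<forall>x. q x \<le> p x) P)"
      by (rule partial_order_on_relation_ofI) (auto intro: order_trans simp: fun_eq_iff antisym)
  next
    fix C assume C: "C \<in> Chains (relation_of (\<lambda>p q. \<forall>x. q x \<le> p x) P)"
    then have CP: "C \<subseteq> P" and tot: "\<And>p q. \<lbrakk>p \<in> C; q \<in> C\<rbrakk> \<Longrightarrow> (\<forall>x. p x \<le> q x) \<or> (\<forall>x. q x \<le> p x)"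
      by (auto simp: Chains_def relation_of_def)
    show "\<exists>u\<in>P. \<forall>a\<in>C. \<forall>x. u x \<le> a x"
    proof (cases "C = {}")
      case True
      then show ?thesis using r by (auto simp: P_def)
    next
      case False
      have low: "- norm x \<le> p x" if "p \<in> C" for p x
      proof -
        have "p (- x) \<le> norm x"
          using that CP r_le[of "- x"] by (auto simp: P_def intro: order_trans)
        moreover have "- p (- x) \<le> p x"
          using that CP by (intro sublinear_lower) (auto simp: P_def)
        ultimately show ?thesis by simp
      qed
      have le: "(INF p\<in>C. p x) \<le> p x" if "p \<in> C" for p x
        using that low by (intro cINF_lower bdd_belowI[where m = "- norm x"]) auto
      have "sublinear (\<lambda>x. INF p\<in>C. p x)"
      proof (rule sublinear_INF[where L = "\<lambda>x. - norm x"])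
        fix p q x y assume "p \<in> C" "q \<in> C"
        moreover from this have "p (x + y) \<le> p x + p y" "q (x + y) \<le> q x + q y"
          using CP by (auto simp: P_def sublinear_def)
        ultimately show "\<exists>k\<in>C. k (x + y) \<le> p x + q y"
          using tot[of p q] by (metis add_left_mono add_right_mono order_trans)
      next
        fix p x and c :: real assume "p \<in> C" "c > 0"
        then show "\<exists>k\<in>C. k (c *\<^sub>R x) \<le> c * p x"
          using CP by (intro bexI[of _ p]) (auto simp: P_def sublinear_def)
      qed (use False low in auto)
      moreover have "(INF p\<in>C. p x) \<le> ?r x" for x
      proof -
        from False obtain p where "p \<in> C" by blast
        with le[of p x] CP show ?thesis by (auto simp: P_def intro: order_trans)
      qed
      ultimately show ?thesis using le by (intro bexI[of _ "\<lambda>x. INF p\<in>C. p x"]) (auto simp: P_def)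
    qed
  qed
  then obtain f where f: "f \<in> P" and fmin: "\<And>p. \<lbrakk>p \<in> P; \<And>x. p x \<le> f x\<rbrakk> \<Longrightarrow> p = f"
    by blast
  have lin: "linear f"
    using f fmin by (intro sublinear_minimal_imp_linear) (auto simp: P_def intro: order_trans)
  have fr: "f x \<le> ?r x" for x using f by (simp add: P_def)
  have up: "f x \<le> norm x" for x using fr r_le order_trans by blast
  have abs: "\<bar>f x\<bar> \<le> norm x" for x
    using up[of x] up[of "- x"] linear_neg[OF lin, of x] by simp
  have "f (- x0) \<le> - norm x0"
    using fr[of "- x0"] tilt_le[OF nrm, of 1 x0 "- x0"] by simp
  then have "norm x0 \<le> f x0" using linear_neg[OF lin, of x0] by simp
  with up[of x0] have "f x0 = norm x0" by simp
  with lin abs show ?thesis using that by blast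
qed

lemma dual_ballD:
  assumes "\<phi> \<in> dual_ball smul"
  shows "\<phi> (u + v) = \<phi> u + \<phi> v" "\<phi> (smul c u) = c * \<phi> u" "\<phi> (t *\<^sub>R u) = t *\<^sub>R \<phi> u"
    "norm (\<phi> u) \<le> norm u"
proof -
  have bl: "bounded_linear \<phi>" and o: "onorm \<phi> \<le> 1" and l: "Vector_Spaces.linear smul (*) \<phi>"
    using assms by (auto simp: dual_ball_def)
  show "\<phi> (u + v) = \<phi> u + \<phi> v" "\<phi> (smul c u) = c * \<phi> u"
    using l by (auto simp: Vector_Spaces.linear_iff)
  show "\<phi> (t *\<^sub>R u) = t *\<^sub>R \<phi> u" using bl by (simp add: linear_simps)
  show "norm (\<phi> u) \<le> norm u"
    using onorm[OF bl, of u] mult_right_mono[OF o, of "norm u"] by simp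
qed

lemma real_norming_dual_ball:
  "\<exists>\<phi>\<in>dual_ball (scaleR :: real \<Rightarrow> 'a::real_normed_vector \<Rightarrow> 'a). norm x \<le> norm (\<phi> x)"
proof -
  obtain f :: "'a \<Rightarrow> real" where f: "linear f" "\<And>v. \<bar>f v\<bar> \<le> norm v" "f x = norm x"
    using real_norming_functional by blast
  have "bounded_linear f"
    by (rule bounded_linear_intro[where K = 1]) (use f in \<open>auto simp: linear_add linear_cmul\<close>)
  moreover have "onorm f \<le> 1" by (rule onorm_bound) (use f in auto)
  moreover have "Vector_Spaces.linear scaleR (*) f"
    using f(1) by (simp add: linear_def real_scaleR_def[abs_def])
  ultimately show ?thesis using f(3) by (intro bexI[of _ f]) (auto simp: dual_ball_def)
qed

text \<open>A complex functional is determined by its real part \<open>f\<close> as \<open>u \<mapsto> f u - \<i> f (\<i> u)\<close>, and it has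
  the same norm, because every value can be rotated onto the positive real axis.\<close>

lemma complex_norming_dual_ball:
  fixes scaleC :: "complex \<Rightarrow> 'a::real_normed_vector \<Rightarrow> 'a"
  assumes "normed_scaling scaleC"
  shows "\<exists>\<phi>\<in>dual_ball scaleC. norm x \<le> norm (\<phi> x)"
proof -
  interpret normed_scaling scaleC by fact
  obtain f :: "'a \<Rightarrow> real" where f: "linear f" "\<And>v. \<bar>f v\<bar> \<le> norm v" "f x = norm x"
    using real_norming_functional by blast
  define \<phi> where "\<phi> u = Complex (f u) (- f (scaleC \<i> u))" for u
  have dec: "scaleC c u = Re c *\<^sub>R u + Im c *\<^sub>R scaleC \<i> u" for c u
  proof -
    have "scaleC c u = scaleC (of_real (Re c) + of_real (Im c) * \<i>) u"
      by (simp add: complex_eq[symmetric] mult.commute)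
    then show ?thesis by (simp add: scale_left_distrib smul_of_real flip: scale_scale)
  qed
  have deci: "scaleC \<i> (scaleC c u) = Re c *\<^sub>R scaleC \<i> u - Im c *\<^sub>R u" for c u
    using dec[of "\<i> * c" u] by simp
  have add: "\<phi> (u + v) = \<phi> u + \<phi> v" for u v
    using f(1) by (simp add: \<phi>_def complex_eq_iff scale_right_distrib linear_add)
  have hom: "\<phi> (scaleC c u) = c * \<phi> u" for c u
  proof -
    have "f (scaleC c u) = Re c * f u + Im c * f (scaleC \<i> u)"
      unfolding dec[of c u] using f(1) by (simp add: linear_add linear_cmul)
    moreover have "f (scaleC \<i> (scaleC c u)) = Re c * f (scaleC \<i> u) - Im c * f u"
      unfolding deci using f(1) by (simp add: linear_diff linear_cmul)
    ultimately show ?thesis by (simp add: \<phi>_def complex_eq_iff)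
  qed
  have homR: "\<phi> (t *\<^sub>R u) = t *\<^sub>R \<phi> u" for t u
    using hom[of "of_real t" u] by (simp add: smul_of_real scaleR_conv_of_real)
  have bd: "norm (\<phi> u) \<le> norm u" for u
  proof (cases "\<phi> u = 0")
    case False
    define c where "c = cnj (\<phi> u) / norm (\<phi> u)"
    have c: "norm c = 1" using False by (simp add: c_def norm_divide)
    have "c * \<phi> u = of_real (norm (\<phi> u))"
      using False by (simp add: c_def complex_norm_square[symmetric] power2_eq_square mult.commute)
    then have "norm (\<phi> u) = Re (\<phi> (scaleC c u))" by (simp add: hom)
    also have "\<dots> = f (scaleC c u)" by (simp add: \<phi>_def)
    also have "\<dots> \<le> norm (scaleC c u)" using f(2) abs_le_D1 by blast
    also have "\<dots> = norm u" using c by (simp add: norm_smul)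
    finally show ?thesis .
  qed simp
  have "bounded_linear \<phi>"
    by (rule bounded_linear_intro[where K = 1]) (use add homR bd in auto)
  moreover have "onorm \<phi> \<le> 1" by (rule onorm_bound) (use bd in auto)
  moreover have "Vector_Spaces.linear scaleC (*) \<phi>"
  proof -
    have "vector_space ((*) :: complex \<Rightarrow> complex \<Rightarrow> complex)"
      by unfold_locales (auto simp: algebra_simps)
    then show ?thesis using add hom vector_space_axioms by (simp add: Vector_Spaces.linear_iff)
  qed
  moreover have "norm x \<le> norm (\<phi> x)"
    using f(3) abs_Re_le_cmod[of "\<phi> x"] by (simp add: \<phi>_def)
  ultimately show ?thesis by (intro bexI[of _ \<phi>]) (auto simp: dual_ball_def)
qed

section \<open>Averages over signs\<close>

definition sign_mean :: "nat set \<Rightarrow> ((nat \<Rightarrow> real) \<Rightarrow> real) \<Rightarrow> real" where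
  "sign_mean U f = (\<Sum>\<epsilon>\<in>U \<rightarrow>\<^sub>E {-1, 1}. f \<epsilon>) / 2 ^ card U"

text \<open>The mean runs over signs on a set \<open>U\<close> that may be larger than the support \<open>S\<close> of the sum.  All
  subsets of one index set can then be compared over the same sample space.\<close>

definition rad :: "nat set \<Rightarrow> nat set \<Rightarrow> (nat \<Rightarrow> 'a::real_normed_vector) \<Rightarrow> real" where
  "rad U S x = sign_mean U (\<lambda>\<epsilon>. (norm (\<Sum>j\<in>S. \<epsilon> j *\<^sub>R x j))\<^sup>2)"

lemma rademacher_mean_sq: "(rademacher_mean n x)\<^sup>2 = rad {..<n} {..<n} x"
  by (simp add: rademacher_mean_def rad_def sign_mean_def sum_nonneg)

lemma rademacher_mean_nonneg: "0 \<le> rademacher_mean n x"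
  by (simp add: rademacher_mean_def sum_nonneg)

lemma sign_mean_mono: "(\<And>\<epsilon>. \<epsilon> \<in> U \<rightarrow>\<^sub>E {-1, 1} \<Longrightarrow> f \<epsilon> \<le> g \<epsilon>) \<Longrightarrow> sign_mean U f \<le> sign_mean U g"
  unfolding sign_mean_def by (intro divide_right_mono sum_mono) auto

lemma sign_mean_cong: "(\<And>\<epsilon>. \<epsilon> \<in> U \<rightarrow>\<^sub>E {-1, 1} \<Longrightarrow> f \<epsilon> = g \<epsilon>) \<Longrightarrow> sign_mean U f = sign_mean U g"
  unfolding sign_mean_def by (simp cong: sum.cong)

lemma sign_mean_add: "sign_mean U (\<lambda>\<epsilon>. f \<epsilon> + g \<epsilon>) = sign_mean U f + sign_mean U g"
  by (simp add: sign_mean_def sum.distrib add_divide_distrib)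

lemma sign_mean_cmult: "sign_mean U (\<lambda>\<epsilon>. c * f \<epsilon>) = c * sign_mean U f"
  by (simp add: sign_mean_def sum_distrib_left)

lemma sign_mean_sum: "sign_mean U (\<lambda>\<epsilon>. \<Sum>i\<in>I. f i \<epsilon>) = (\<Sum>i\<in>I. sign_mean U (f i))"
  by (simp add: sign_mean_def sum_divide_distrib sum.swap[of _ I])

lemma sign_mean_swap:
  "sign_mean U (\<lambda>\<epsilon>. sign_mean V (\<lambda>\<eta>. f \<epsilon> \<eta>)) = sign_mean V (\<lambda>\<eta>. sign_mean U (\<lambda>\<epsilon>. f \<epsilon> \<eta>))"
  unfolding sign_mean_def
  by (simp add: sum_divide_distrib[symmetric] sum.swap[of _ "V \<rightarrow>\<^sub>E {-1, 1}"])

lemma card_signs: "finite U \<Longrightarrow> card (U \<rightarrow>\<^sub>E {-1, 1::real}) = 2 ^ card U"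
  by (simp add: card_PiE numeral_2_eq_2)

lemma sign_mean_const: "finite U \<Longrightarrow> sign_mean U (\<lambda>\<epsilon>. c) = c"
  by (simp add: sign_mean_def card_signs)

lemma sign_mean_flip:
  assumes \<sigma>: "\<And>j. j \<in> U \<Longrightarrow> \<sigma> j \<in> {-1, 1::real}"
  shows "sign_mean U (\<lambda>\<epsilon>. f (restrict (\<lambda>j. \<sigma> j * \<epsilon> j) U)) = sign_mean U f"
proof -
  let ?F = "\<lambda>\<epsilon>. restrict (\<lambda>j. \<sigma> j * \<epsilon> j) U"
  have mem: "?F \<epsilon> \<in> U \<rightarrow>\<^sub>E {-1, 1}" if "\<epsilon> \<in> U \<rightarrow>\<^sub>E {-1, 1}" for \<epsilon>
    using that \<sigma> by (fastforce simp: PiE_iff)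
  have inv: "?F (?F \<epsilon>) = \<epsilon>" if "\<epsilon> \<in> U \<rightarrow>\<^sub>E {-1, 1}" for \<epsilon>
  proof
    fix j
    show "?F (?F \<epsilon>) j = \<epsilon> j"
      using \<sigma>[of j] PiE_arb[OF that, of j] by (cases "j \<in> U") auto
  qed
  have "(\<Sum>\<epsilon>\<in>U \<rightarrow>\<^sub>E {-1, 1}. f (?F \<epsilon>)) = (\<Sum>\<epsilon>\<in>U \<rightarrow>\<^sub>E {-1, 1}. f \<epsilon>)"
    by (rule sum.reindex_bij_witness[where i = ?F and j = ?F]) (use mem inv in auto)
  then show ?thesis by (simp add: sign_mean_def)
qed

lemma rad_flip:
  assumes \<sigma>: "\<And>j. j \<in> U \<Longrightarrow> \<sigma> j \<in> {-1, 1::real}" and S: "S \<subseteq> U"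
  shows "sign_mean U (\<lambda>\<epsilon>. (norm (\<Sum>j\<in>S. (\<sigma> j * \<epsilon> j) *\<^sub>R x j))\<^sup>2) = rad U S x"
proof -
  have "(\<Sum>j\<in>S. (\<sigma> j * \<epsilon> j) *\<^sub>R x j) = (\<Sum>j\<in>S. restrict (\<lambda>j. \<sigma> j * \<epsilon> j) U j *\<^sub>R x j)" for \<epsilon>
    using S by (intro sum.cong) auto
  then show ?thesis
    using sign_mean_flip[OF \<sigma>, where f = "\<lambda>\<epsilon>. (norm (\<Sum>j\<in>S. \<epsilon> j *\<^sub>R x j))\<^sup>2"]
    by (simp add: rad_def)
qed

lemma rad_singleton: "finite U \<Longrightarrow> j \<in> U \<Longrightarrow> rad U {j} x = (norm (x j))\<^sup>2"
proof -
  assume "finite U" "j \<in> U"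
  have "rad U {j} x = sign_mean U (\<lambda>\<epsilon>. (norm (x j))\<^sup>2)"
    unfolding rad_def
    by (rule sign_mean_cong) (use \<open>j \<in> U\<close> in \<open>auto simp: PiE_iff power_mult_distrib dest!: bspec\<close>)
  then show ?thesis using sign_mean_const[OF \<open>finite U\<close>] by simp
qed

text \<open>Reversing all the signs on \<open>T\<close> does not change the mean.\<close>

lemma rad_two_blocks:
  assumes U: "finite U" and S: "S \<union> T \<subseteq> U" "S \<inter> T = {}"
  shows "2 * rad U (S \<union> T) x = sign_mean U (\<lambda>\<epsilon>.
     (norm ((\<Sum>j\<in>S. \<epsilon> j *\<^sub>R x j) + (\<Sum>j\<in>T. \<epsilon> j *\<^sub>R x j)))\<^sup>2
   + (norm ((\<Sum>j\<in>S. \<epsilon> j *\<^sub>R x j) - (\<Sum>j\<in>T. \<epsilon> j *\<^sub>R x j)))\<^sup>2)"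
proof -
  let ?\<sigma> = "\<lambda>j. if j \<in> T then -1 else 1::real"
  have fin: "finite S" "finite T" using U S by (auto intro: finite_subset)
  have plus: "(\<Sum>j\<in>S \<union> T. \<epsilon> j *\<^sub>R x j) = (\<Sum>j\<in>S. \<epsilon> j *\<^sub>R x j) + (\<Sum>j\<in>T. \<epsilon> j *\<^sub>R x j)" for \<epsilon>
    using fin S by (intro sum.union_disjoint) auto
  have minus: "(\<Sum>j\<in>S \<union> T. (?\<sigma> j * \<epsilon> j) *\<^sub>R x j) = (\<Sum>j\<in>S. \<epsilon> j *\<^sub>R x j) - (\<Sum>j\<in>T. \<epsilon> j *\<^sub>R x j)" for \<epsilon>
  proof -
    have "(\<Sum>j\<in>S \<union> T. (?\<sigma> j * \<epsilon> j) *\<^sub>R x j) =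
        (\<Sum>j\<in>S. (?\<sigma> j * \<epsilon> j) *\<^sub>R x j) + (\<Sum>j\<in>T. (?\<sigma> j * \<epsilon> j) *\<^sub>R x j)"
      using fin S by (intro sum.union_disjoint) auto
    also have "(\<Sum>j\<in>S. (?\<sigma> j * \<epsilon> j) *\<^sub>R x j) = (\<Sum>j\<in>S. \<epsilon> j *\<^sub>R x j)"
      using S by (intro sum.cong) auto
    finally show ?thesis by (simp add: sum_negf)
  qed
  show ?thesis
    using rad_flip[of U ?\<sigma> "S \<union> T" x] S
    by (simp add: sign_mean_add minus plus rad_def del: if_split_asm)
qed

text \<open>Averaging over a simultaneous change of the signs on \<open>T - S\<close> can only decrease the norm, by
  convexity.\<close>

lemma rad_mono:
  assumes U: "finite U" and S: "S \<subseteq> T" "T \<subseteq> U"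
  shows "rad U S x \<le> rad U T x"
proof -
  have *: "2 * (norm a)\<^sup>2 \<le> (norm (a + b))\<^sup>2 + (norm (a - b))\<^sup>2" for a b :: 'a
  proof -
    have "2 * norm a = norm ((a + b) + (a - b))" by (simp flip: scaleR_2)
    also have "\<dots> \<le> norm (a + b) + norm (a - b)" by (rule norm_triangle_ineq)
    finally have "(2 * norm a)\<^sup>2 \<le> (norm (a + b) + norm (a - b))\<^sup>2" by (intro power_mono) auto
    also have "\<dots> \<le> 2 * ((norm (a + b))\<^sup>2 + (norm (a - b))\<^sup>2)"
      using sum_squares_bound[of "norm (a + b)" "norm (a - b)"] by (simp add: power2_sum)
    finally show ?thesis by (simp add: power_mult_distrib)
  qed
  have "S \<union> (T - S) = T" using S by auto
  then have "2 * rad U T x \<ge> 2 * rad U S x"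
    using rad_two_blocks[OF U, of S "T - S" x] S
    unfolding rad_def[of U S] sign_mean_cmult[symmetric]
    by (auto intro!: sign_mean_mono *)
  then show ?thesis by simp
qed

lemma rad_nonneg: "0 \<le> rad U S x"
  by (simp add: rad_def sign_mean_def sum_nonneg)

lemma norm_sq_le_rad:
  assumes "finite U" "j \<in> U" shows "(norm (x j))\<^sup>2 \<le> rad U U x"
  using rad_mono[of U "{j}" U x] rad_singleton[of U j x] assms by simp

text \<open>For real numbers the signs are orthonormal, so that the mean square of the signed sums is exactly
  the sum of the squares.\<close>

lemma sum_sq_functional_le_rad:
  fixes x :: "nat \<Rightarrow> 'a::real_normed_vector"
  assumes f: "linear f" "\<And>x. \<bar>f x\<bar> \<le> norm x" and U: "finite U" "S \<subseteq> U"
  shows "(\<Sum>j\<in>S. (f (x j))\<^sup>2) \<le> rad U S x"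
proof -
  let ?y = "\<lambda>j. f (x j) :: real"
  have "finite S" using U finite_subset by blast
  then have "(\<Sum>j\<in>S. (?y j)\<^sup>2) = rad U S ?y" using U(2)
  proof (induction S)
    case empty
    then show ?case by (simp add: rad_def sign_mean_def)
  next
    case (insert j S)
    have "2 * rad U (insert j S) ?y = 2 * rad U S ?y + 2 * rad U {j} ?y"
      using rad_two_blocks[OF U(1), of "{j}" S ?y] insert
      by (simp add: rad_def sign_mean_add[symmetric] sign_mean_cmult[symmetric] algebra_simps
          power2_sum power2_diff)
    then show ?case using insert rad_singleton[OF U(1), of j ?y] by simp
  qed
  also have "\<dots> \<le> rad U S x"
    unfolding rad_def
  proof (rule sign_mean_mono)
    fix \<epsilon>
    have "(\<Sum>j\<in>S. \<epsilon> j *\<^sub>R f (x j)) = f (\<Sum>j\<in>S. \<epsilon> j *\<^sub>R x j)"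
      using f(1) by (simp add: linear_sum linear_cmul)
    then show "(norm (\<Sum>j\<in>S. \<epsilon> j *\<^sub>R f (x j)))\<^sup>2 \<le> (norm (\<Sum>j\<in>S. \<epsilon> j *\<^sub>R x j))\<^sup>2"
      using f(2) by (simp flip: abs_le_square_iff)
  qed
  finally show ?thesis .
qed

lemma exists_signs_le_rad:
  assumes U: "finite U"
  obtains \<epsilon> where "\<epsilon> \<in> U \<rightarrow>\<^sub>E {-1, 1}" "(norm (\<Sum>j\<in>S. \<epsilon> j *\<^sub>R x j))\<^sup>2 \<le> rad U S x"
proof (rule ccontr)
  assume "\<not> thesis"
  then have less: "\<And>\<epsilon>. \<epsilon> \<in> U \<rightarrow>\<^sub>E {-1, 1} \<Longrightarrow> rad U S x < (norm (\<Sum>j\<in>S. \<epsilon> j *\<^sub>R x j))\<^sup>2"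
    using that by (meson not_le)
  have "(U \<rightarrow>\<^sub>E {-1, 1::real}) \<noteq> {}" by (simp add: PiE_eq_empty_iff)
  then have "sign_mean U (\<lambda>\<epsilon>. rad U S x) < rad U S x"
    unfolding sign_mean_def rad_def[of U S x] using U less
    by (intro divide_strict_right_mono sum_strict_mono) (auto intro: finite_PiE simp: rad_def[of U S x, unfolded sign_mean_def])
  then show False by (simp add: sign_mean_const U)
qed

text \<open>Signs on the blocks may be chosen in two stages, first inside the blocks and then one further
  sign for each block.  For fixed inner signs, the hypothesis applies to the block sums.\<close>

lemma sum_rad_blocks_le:
  fixes x :: "nat \<Rightarrow> 'a::real_normed_vector"
  assumes U: "finite U" and S: "\<And>b. b < n \<Longrightarrow> S b \<subseteq> U"
    and disj: "\<And>b c. \<lbrakk>b < n; c < n; b \<noteq> c\<rbrakk> \<Longrightarrow> S b \<inter> S c = {}"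
    and D: "\<And>y :: nat \<Rightarrow> 'a. (\<Sum>b<n. (norm (y b))\<^sup>2) \<le> D * (rademacher_mean n y)\<^sup>2"
    and D0: "0 \<le> D"
  shows "(\<Sum>b<n. rad U (S b) x) \<le> D * rad U U x"
proof -
  let ?T = "\<Union>b<n. S b"
  let ?y = "\<lambda>\<epsilon> b. \<Sum>j\<in>S b. \<epsilon> j *\<^sub>R x j"
  have T: "?T \<subseteq> U" using S by auto
  have signed: "sign_mean U (\<lambda>\<epsilon>. (norm (\<Sum>b<n. \<eta> b *\<^sub>R ?y \<epsilon> b))\<^sup>2) = rad U ?T x"
    if \<eta>: "\<eta> \<in> {..<n} \<rightarrow>\<^sub>E {-1, 1}" for \<eta>
  proof -
    define \<sigma> where "\<sigma> j = (if \<exists>b<n. j \<in> S b then \<eta> (THE b. b < n \<and> j \<in> S b) else 1)" for j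
    have the: "(THE b. b < n \<and> j \<in> S b) = b" if "b < n" "j \<in> S b" for b j
      using that disj by (intro the_equality) blast+
    have \<sigma>: "\<sigma> j = \<eta> b" if "b < n" "j \<in> S b" for b j
      using that the[OF that] by (auto simp: \<sigma>_def)
    have \<sigma>1: "\<sigma> j \<in> {-1, 1}" for j
      using \<sigma> \<eta> by (cases "\<exists>b<n. j \<in> S b") (auto simp: \<sigma>_def[of j] PiE_iff the)
    have "(\<Sum>b<n. \<eta> b *\<^sub>R ?y \<epsilon> b) = (\<Sum>j\<in>?T. (\<sigma> j * \<epsilon> j) *\<^sub>R x j)" for \<epsilon>
    proof -
      have "(\<Sum>j\<in>?T. (\<sigma> j * \<epsilon> j) *\<^sub>R x j) = (\<Sum>b<n. \<Sum>j\<in>S b. (\<sigma> j * \<epsilon> j) *\<^sub>R x j)"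
        using S U disj by (intro sum.UNION_disjoint) (auto intro: finite_subset)
      also have "\<dots> = (\<Sum>b<n. \<Sum>j\<in>S b. \<eta> b *\<^sub>R \<epsilon> j *\<^sub>R x j)"
        by (intro sum.cong) (auto simp: \<sigma>)
      finally show ?thesis by (simp add: scaleR_sum_right)
    qed
    then show ?thesis using rad_flip[OF \<sigma>1 T] by simp
  qed
  have "(\<Sum>b<n. rad U (S b) x) = sign_mean U (\<lambda>\<epsilon>. \<Sum>b<n. (norm (?y \<epsilon> b))\<^sup>2)"
    by (simp add: rad_def sign_mean_sum)
  also have "\<dots> \<le> sign_mean U (\<lambda>\<epsilon>. D * rad {..<n} {..<n} (?y \<epsilon>))"
    using D[of "?y _"] by (intro sign_mean_mono) (simp add: rademacher_mean_sq)
  also have "\<dots> = D * sign_mean {..<n} (\<lambda>\<eta>. sign_mean U (\<lambda>\<epsilon>. (norm (\<Sum>b<n. \<eta> b *\<^sub>R ?y \<epsilon> b))\<^sup>2))"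
    by (simp only: sign_mean_cmult rad_def[of "{..<n}"] sign_mean_swap[of U])
  also have "\<dots> = D * sign_mean {..<n} (\<lambda>\<eta>. rad U ?T x)"
    by (simp cong: sign_mean_cong add: signed)
  also have "\<dots> = D * rad U ?T x" by (simp add: sign_mean_const)
  also have "\<dots> \<le> D * rad U U x" using rad_mono[OF U T] D0 by (intro mult_left_mono) auto
  finally show ?thesis .
qed

section \<open>Dominated forms and the Orlicz property\<close>

definition scalar_bilinear :: "('k::real_normed_field \<Rightarrow> 'a::real_normed_vector \<Rightarrow> 'a) \<Rightarrow> ('a \<Rightarrow>\<^sub>L 'a \<Rightarrow>\<^sub>L 'k) set" where
  "scalar_bilinear smul =
     {F :: 'a \<Rightarrow>\<^sub>L 'a \<Rightarrow>\<^sub>L 'k. \<forall>c u v. F (smul c u) v = c * F u v \<and> F u (smul c v) = c * F u v}"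

lemma closed_scalar_bilinear: "closed (scalar_bilinear smul)"
  unfolding scalar_bilinear_def
  by (intro closed_Collect_all closed_Collect_conj closed_Collect_eq continuous_intros)

lemma scalar_bilinear_add: "F \<in> scalar_bilinear smul \<Longrightarrow> G \<in> scalar_bilinear smul \<Longrightarrow> F + G \<in> scalar_bilinear smul"
  by (simp add: scalar_bilinear_def blinfun.add_left algebra_simps)

lemma scalar_bilinear_scaleR: "F \<in> scalar_bilinear smul \<Longrightarrow> t *\<^sub>R F \<in> scalar_bilinear smul"
  by (simp add: scalar_bilinear_def blinfun.scaleR_left)

lemma scalar_bilinear_cont:
  fixes smul :: "'k::real_normed_field \<Rightarrow> 'a::real_normed_vector \<Rightarrow> 'a"
  assumes smul: "normed_scaling smul" and F: "F \<in> scalar_bilinear smul"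
  shows "(\<lambda>u v. F u v) \<in> cont_bilinear_forms smul"
proof -
  have "vector_space smul" using smul by (simp add: normed_scaling_def)
  moreover have "vector_space ((*) :: 'k \<Rightarrow> 'k \<Rightarrow> 'k)"
    by unfold_locales (auto simp: algebra_simps)
  moreover have "continuous_on UNIV (\<lambda>(u, v). F u v)"
    unfolding case_prod_unfold by (intro continuous_intros)
  ultimately show ?thesis
    using F by (auto simp: cont_bilinear_forms_def scalar_bilinear_def Vector_Spaces.linear_iff
        blinfun.add_left blinfun.add_right)
qed

text \<open>Baire's theorem on the Banach space of scalar bilinear forms, for the closed sets of those \<open>F\<close>
  whose sum over all \<open>j\<close> is at most \<open>m\<close>.  Since the square root is subadditive, a bound on some
  ball can be moved to the unit ball.\<close>

lemma dominated_imp_bounded_on_ball: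
  fixes smul :: "'k::{real_normed_field,banach} \<Rightarrow> 'a::real_normed_vector \<Rightarrow> 'a"
  assumes smul: "normed_scaling smul"
    and dom: "dominated_forms smul 1 = cont_bilinear_forms smul"
    and x: "weakly_summable smul 1 x"
  obtains M where "\<And>F n. \<lbrakk>F \<in> scalar_bilinear smul; norm F \<le> 1\<rbrakk>
                     \<Longrightarrow> (\<Sum>j<n. sqrt (norm (F (x j) (x j)))) \<le> M"
proof -
  let ?Z = "scalar_bilinear smul"
  let ?p = "\<lambda>n F. \<Sum>j<n. sqrt (norm (blinfun_apply (blinfun_apply F (x j)) (x j)))"
  define E where "E m = {F \<in> ?Z. \<forall>n. ?p n F \<le> real m}" for m
  have cover: "?Z = \<Union>(range E)"
  proof (intro equalityI subsetI)
    fix F assume F: "F \<in> ?Z"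
    then have "(\<lambda>u v. F u v) \<in> dominated_forms smul 1"
      using scalar_bilinear_cont[OF smul] dom by simp
    then have "summable (\<lambda>j. norm (F (x j) (x j)) powr (1 / 2))"
      using x unfolding dominated_forms_def by blast
    then have s: "summable (\<lambda>j. sqrt (norm (F (x j) (x j))))" by (simp add: powr_half_sqrt)
    obtain m where "(\<Sum>j. sqrt (norm (F (x j) (x j)))) \<le> real m" using real_arch_simple by blast
    moreover have "?p n F \<le> (\<Sum>j. sqrt (norm (F (x j) (x j))))" for n
      using s by (intro sum_le_suminf) auto
    ultimately have "?p n F \<le> real m" for n using order_trans by blast
    then show "F \<in> \<Union>(range E)" using F by (auto simp: E_def)
  qed (auto simp: E_def)
  have "closed (E m)" for m
  proof -
    have "E m = ?Z \<inter> {F. \<forall>n. ?p n F \<le> real m}" by (auto simp: E_def)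
    moreover have "closed {F. \<forall>n. ?p n F \<le> real m}"
      by (intro closed_Collect_all closed_Collect_le continuous_intros)
    ultimately show ?thesis using closed_scalar_bilinear by auto
  qed
  then have cl: "closedin (top_of_set ?Z) (E m)" for m
    by (rule closed_subset[rotated]) (auto simp: E_def)
  have "\<exists>m. top_of_set ?Z interior_of E m \<noteq> {}"
  proof (rule ccontr)
    assume "\<not> ?thesis"
    then have "top_of_set ?Z interior_of \<Union>(range E) = {}"
      using cl by (intro Baire_category_alt disjI1 completely_metrizable_space_closedin
          completely_metrizable_space_euclidean) (auto simp: closed_scalar_bilinear)
    then have "?Z = {}" using cover interior_of_topspace[of "top_of_set ?Z"] by simp
    moreover have "0 \<in> ?Z" by (simp add: scalar_bilinear_def)
    ultimately show False by blast
  qed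
  then obtain m F0 where F0: "F0 \<in> top_of_set ?Z interior_of E m" by blast
  have "openin (top_of_set ?Z) (top_of_set ?Z interior_of E m)" by simp
  then obtain T where T: "open T" "top_of_set ?Z interior_of E m = ?Z \<inter> T"
    unfolding openin_open by blast
  then obtain r where r: "r > 0" "ball F0 r \<subseteq> T" using F0 open_contains_ball by blast
  have F0Z: "F0 \<in> ?Z" using F0 T by auto
  have near: "F \<in> E m" if "F \<in> ?Z" "dist F0 F < r" for F
    using that r T interior_of_subset[of "top_of_set ?Z" "E m"] by auto
  have "?p n F \<le> 2 * real m / sqrt (r / 2)" if F: "F \<in> ?Z" "norm F \<le> 1" for F n
  proof -
    let ?G = "F0 + (r / 2) *\<^sub>R F"
    have "norm ((r / 2) *\<^sub>R F) \<le> r / 2" using F r mult_left_mono[of "norm F" 1 "r/2"] by simp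
    then have "?G \<in> E m"
      using r F F0Z by (intro near scalar_bilinear_add scalar_bilinear_scaleR) (auto simp: dist_norm)
    moreover have "F0 \<in> E m" using r F0Z by (intro near) auto
    ultimately have *: "?p n ?G \<le> m" "?p n F0 \<le> m" by (auto simp: E_def)
    have "sqrt (r / 2) * ?p n F = (\<Sum>j<n. sqrt (norm ((r / 2) *\<^sub>R F (x j) (x j))))"
      using r by (simp add: sum_distrib_left real_sqrt_mult real_sqrt_divide)
    also have "\<dots> \<le> (\<Sum>j<n. sqrt (norm (?G (x j) (x j))) + sqrt (norm (F0 (x j) (x j))))"
    proof (rule sum_mono)
      fix j
      have "norm ((r / 2) *\<^sub>R F (x j) (x j)) = norm (?G (x j) (x j) - F0 (x j) (x j))"
        by (simp add: blinfun.add_left blinfun.scaleR_left)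
      also have "\<dots> \<le> norm (?G (x j) (x j)) + norm (F0 (x j) (x j))" by (rule norm_triangle_ineq4)
      finally have "sqrt (norm ((r / 2) *\<^sub>R F (x j) (x j))) \<le>
          sqrt (norm (?G (x j) (x j)) + norm (F0 (x j) (x j)))" by (rule real_sqrt_le_mono)
      also have "\<dots> \<le> sqrt (norm (?G (x j) (x j))) + sqrt (norm (F0 (x j) (x j)))"
        by (intro sqrt_add_le_add_sqrt) auto
      finally show "sqrt (norm ((r / 2) *\<^sub>R F (x j) (x j))) \<le>
          sqrt (norm (?G (x j) (x j))) + sqrt (norm (F0 (x j) (x j)))" .
    qed
    also have "\<dots> \<le> 2 * real m" using * by (simp add: sum.distrib)
    finally show ?thesis using r by (simp add: pos_le_divide_eq mult.commute)
  qed
  then show ?thesis using that by blast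
qed

lemma blinfun_of_bilinear:
  fixes A :: "'a::real_normed_vector \<Rightarrow> 'b::real_normed_vector \<Rightarrow> 'c::real_normed_vector"
  assumes l1: "\<And>v. linear (\<lambda>u. A u v)" and l2: "\<And>u. linear (A u)"
    and bd: "\<And>u v. norm (A u v) \<le> K * norm u * norm v" and K: "K \<ge> 0"
  obtains F :: "'a \<Rightarrow>\<^sub>L 'b \<Rightarrow>\<^sub>L 'c" where "\<And>u v. F u v = A u v" "norm F \<le> K"
proof -
  have bl: "bounded_linear (A u)" for u
    using l2[of u] bd[of u]
    by (intro bounded_linear_intro[where K = "K * norm u"])
       (auto simp: linear_add linear_cmul mult.commute)
  have nb: "norm (Blinfun (A u)) \<le> K * norm u" for u
    using bd[of u] K by (intro norm_blinfun_bound) (auto simp: bounded_linear_Blinfun_apply[OF bl])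
  have blF: "bounded_linear (\<lambda>u. Blinfun (A u))"
  proof (rule bounded_linear_intro[where K = K])
    show "Blinfun (A (u + w)) = Blinfun (A u) + Blinfun (A w)" for u w
      using linear_add[OF l1]
      by (intro blinfun_eqI) (simp add: bounded_linear_Blinfun_apply[OF bl] blinfun.add_left)
    show "Blinfun (A (t *\<^sub>R u)) = t *\<^sub>R Blinfun (A u)" for t u
      using linear_cmul[OF l1]
      by (intro blinfun_eqI) (simp add: bounded_linear_Blinfun_apply[OF bl] blinfun.scaleR_left)
    show "norm (Blinfun (A u)) \<le> norm u * K" for u using nb by (simp add: mult.commute)
  qed
  let ?F = "Blinfun (\<lambda>u. Blinfun (A u))"
  have ap: "blinfun_apply ?F u = Blinfun (A u)" for u
    by (simp add: bounded_linear_Blinfun_apply[OF blF])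
  show ?thesis
  proof
    show "blinfun_apply (blinfun_apply ?F u) v = A u v" for u v
      by (simp add: ap bounded_linear_Blinfun_apply[OF bl])
    show "norm ?F \<le> K"
    proof (rule norm_blinfun_bound[OF K])
      show "norm (blinfun_apply ?F u) \<le> K * norm u" for u using nb by (simp add: ap)
    qed
  qed
qed

text \<open>Changing the \<open>j\<close>-th sign alone moves \<open>A(x\<^sub>j, x\<^sub>j)\<close> by \<open>2 a\<^sub>j \<phi>\<^sub>j(x\<^sub>j)\<^sup>2\<close>, so that for at least one of the
  two signs the modulus is not less than half of this.  The exponent \<open>1/2\<close> is what makes the
  resulting bound useful: it turns the weights \<open>a\<^sub>j\<close>, which sum to \<open>1\<close>, into \<open>a\<^sub>j\<^bsup>1/2\<^esup>\<close>.\<close>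

lemma sum_norm_sq_le_of_bounded_on_ball:
  fixes smul :: "'k::{real_normed_field,banach} \<Rightarrow> 'a::real_normed_vector \<Rightarrow> 'a"
    and x :: "nat \<Rightarrow> 'a"
  assumes norming: "\<And>x. \<exists>\<phi>\<in>dual_ball smul. norm x \<le> norm (\<phi> x)"
    and M: "\<And>F n. \<lbrakk>F \<in> scalar_bilinear smul; norm F \<le> 1\<rbrakk>
                     \<Longrightarrow> (\<Sum>j<n. sqrt (norm (F (x j) (x j)))) \<le> M"
  shows "(\<Sum>j<n. (norm (x j))\<^sup>2) \<le> 4 * M\<^sup>2"
proof -
  define S where "S = (\<Sum>j<n. (norm (x j))\<^sup>2)"
  show ?thesis
  proof (cases "S = 0")
    case True
    then show ?thesis by (simp add: S_def)
  next
    case False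
    moreover have "S \<ge> 0" by (simp add: S_def sum_nonneg)
    ultimately have S: "S > 0" by simp
    \<comment> \<open>these weights turn the lower bound for the \<open>j\<close>-th term into \<open>\<parallel>x\<^sub>j\<parallel>\<^sup>2 / S\<^bsup>1/2\<^esup>\<close>\<close>
    define a where "a j = (norm (x j))\<^sup>2 / S" for j
    have a0: "a j \<ge> 0" for j using S by (simp add: a_def)
    have a1: "(\<Sum>j<n. a j) = 1" using S by (simp add: a_def S_def flip: sum_divide_distrib)
    from norming have "\<forall>j. \<exists>\<phi>. \<phi> \<in> dual_ball smul \<and> norm (x j) \<le> norm (\<phi> (x j))" by blast
    then obtain \<phi> where \<phi>: "\<And>j. \<phi> j \<in> dual_ball smul" "\<And>j. norm (x j) \<le> norm (\<phi> j (x j))"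
      by metis
    note \<phi>l = dual_ballD[OF \<phi>(1)]
    define A where "A \<epsilon> u v = (\<Sum>j<n. (\<epsilon> j * a j) *\<^sub>R (\<phi> j u * \<phi> j v))" for \<epsilon> u v
    define g where "g \<epsilon> j = sqrt (norm (A \<epsilon> (x j) (x j)))" for \<epsilon> j
    have "(\<Sum>j<n. g \<epsilon> j) \<le> M" if \<epsilon>: "\<epsilon> \<in> {..<n} \<rightarrow>\<^sub>E {-1, 1}" for \<epsilon>
    proof -
      have "norm (A \<epsilon> u v) \<le> 1 * norm u * norm v" for u v
      proof -
        have "norm (A \<epsilon> u v) \<le> (\<Sum>j<n. a j * (norm u * norm v))"
          unfolding A_def
        proof (rule sum_norm_le)
          fix j assume "j \<in> {..<n}"
          with \<epsilon> have "\<bar>\<epsilon> j\<bar> = 1" by (auto simp: PiE_iff dest!: bspec)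
          then have "norm ((\<epsilon> j * a j) *\<^sub>R (\<phi> j u * \<phi> j v)) = a j * (norm (\<phi> j u) * norm (\<phi> j v))"
            using a0 by (simp add: norm_mult abs_mult)
          also have "\<dots> \<le> a j * (norm u * norm v)"
            using a0 \<phi>l(4) by (intro mult_left_mono mult_mono) auto
          finally show "norm ((\<epsilon> j * a j) *\<^sub>R (\<phi> j u * \<phi> j v)) \<le> a j * (norm u * norm v)" .
        qed
        then show ?thesis using a1 by (simp flip: sum_distrib_right)
      qed
      note bd = this
      have l: "linear (\<lambda>u. A \<epsilon> u v)" "linear (A \<epsilon> u)" for u v
        by (auto intro!: linearI simp: A_def \<phi>l scaleR_sum_right algebra_simps sum.distrib)
      obtain F where F: "\<And>u v. blinfun_apply (blinfun_apply F u) v = A \<epsilon> u v" "norm F \<le> 1"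
        by (rule blinfun_of_bilinear[OF l bd]) auto
      have "F \<in> scalar_bilinear smul"
        by (auto simp: scalar_bilinear_def F A_def \<phi>l sum_distrib_left mult.left_commute mult.assoc)
      from M[OF this F(2), of n] show ?thesis by (simp add: F g_def)
    qed
    then have "sign_mean {..<n} (\<lambda>\<epsilon>. \<Sum>j<n. g \<epsilon> j) \<le> sign_mean {..<n} (\<lambda>\<epsilon>. M)"
      by (rule sign_mean_mono)
    then have upper: "(\<Sum>j<n. sign_mean {..<n} (\<lambda>\<epsilon>. g \<epsilon> j)) \<le> M"
      by (simp add: sign_mean_const sign_mean_sum)
    have lower: "sqrt (a j) * norm (x j) \<le> 2 * sign_mean {..<n} (\<lambda>\<epsilon>. g \<epsilon> j)" if j: "j < n" for j
    proof -
      let ?\<sigma> = "\<lambda>i. if i = j then -1 else 1 :: real"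
      let ?f = "\<lambda>\<epsilon>. restrict (\<lambda>i. ?\<sigma> i * \<epsilon> i) {..<n}"
      have pair: "sqrt (a j) * norm (x j) \<le> g \<epsilon> j + g (?f \<epsilon>) j" if \<epsilon>: "\<epsilon> \<in> {..<n} \<rightarrow>\<^sub>E {-1, 1}" for \<epsilon>
      proof -
        let ?t = "\<lambda>\<epsilon> i. (\<epsilon> i * a i) *\<^sub>R (\<phi> i (x j) * \<phi> i (x j))"
        have split: "A \<eta> (x j) (x j) = ?t \<eta> j + (\<Sum>i\<in>{..<n} - {j}. ?t \<eta> i)" for \<eta>
          unfolding A_def using j by (subst sum.remove[of _ j]) auto
        have "(\<Sum>i\<in>{..<n} - {j}. ?t (?f \<epsilon>) i) = (\<Sum>i\<in>{..<n} - {j}. ?t \<epsilon> i)"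
          by (intro sum.cong) auto
        moreover have "?t (?f \<epsilon>) j = - ?t \<epsilon> j" using j by simp
        ultimately have "A (?f \<epsilon>) (x j) (x j) = - ?t \<epsilon> j + (\<Sum>i\<in>{..<n} - {j}. ?t \<epsilon> i)"
          using split[of "?f \<epsilon>"] by argo
        then have "A \<epsilon> (x j) (x j) - A (?f \<epsilon>) (x j) (x j) = 2 *\<^sub>R ?t \<epsilon> j"
          unfolding scaleR_2 using split[of \<epsilon>] by (simp only:) simp
        moreover have "\<bar>\<epsilon> j\<bar> = 1" using \<epsilon> j by (auto simp: PiE_iff dest!: bspec)
        ultimately have "norm (A \<epsilon> (x j) (x j) - A (?f \<epsilon>) (x j) (x j)) = 2 * a j * (norm (\<phi> j (x j)))\<^sup>2"
          using a0 by (simp add: norm_mult abs_mult power2_eq_square)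
        then have "2 * a j * (norm (\<phi> j (x j)))\<^sup>2 \<le> norm (A \<epsilon> (x j) (x j)) + norm (A (?f \<epsilon>) (x j) (x j))"
          using norm_triangle_ineq4 by metis
        moreover have "a j * (norm (x j))\<^sup>2 \<le> 2 * a j * (norm (\<phi> j (x j)))\<^sup>2"
        proof -
          have "a j * (norm (x j))\<^sup>2 \<le> a j * (norm (\<phi> j (x j)))\<^sup>2"
            using a0 \<phi>(2) by (intro mult_left_mono power_mono) auto
          also have "\<dots> \<le> 2 * (a j * (norm (\<phi> j (x j)))\<^sup>2)" using a0[of j] by simp
          finally show ?thesis by simp
        qed
        ultimately have "sqrt (a j * (norm (x j))\<^sup>2) \<le>
            sqrt (norm (A \<epsilon> (x j) (x j)) + norm (A (?f \<epsilon>) (x j) (x j)))"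
          by (intro real_sqrt_le_mono) linarith
        also have "\<dots> \<le> g \<epsilon> j + g (?f \<epsilon>) j"
          unfolding g_def by (intro sqrt_add_le_add_sqrt) auto
        finally show ?thesis by (simp add: real_sqrt_mult)
      qed
      have "sqrt (a j) * norm (x j) = sign_mean {..<n} (\<lambda>\<epsilon>. sqrt (a j) * norm (x j))"
        by (simp add: sign_mean_const)
      also have "\<dots> \<le> sign_mean {..<n} (\<lambda>\<epsilon>. g \<epsilon> j + g (?f \<epsilon>) j)"
        by (rule sign_mean_mono) (rule pair)
      also have "\<dots> = 2 * sign_mean {..<n} (\<lambda>\<epsilon>. g \<epsilon> j)"
        using sign_mean_flip[of "{..<n}" ?\<sigma> "\<lambda>\<epsilon>. g \<epsilon> j"] by (simp add: sign_mean_add)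
      finally show ?thesis .
    qed
    have "sqrt (a j) * norm (x j) = (norm (x j))\<^sup>2 / sqrt S" for j
      by (simp add: a_def real_sqrt_divide power2_eq_square)
    then have "(\<Sum>j<n. sqrt (a j) * norm (x j)) = S / sqrt S"
      by (simp add: S_def flip: sum_divide_distrib)
    also have "\<dots> = sqrt S" using S by (simp add: real_div_sqrt)
    finally have "sqrt S \<le> 2 * (\<Sum>j<n. sign_mean {..<n} (\<lambda>\<epsilon>. g \<epsilon> j))"
      using lower by (simp add: sum_distrib_left) (metis (no_types, lifting) lessThan_iff sum_mono)
    then have "sqrt S \<le> 2 * M" using upper by linarith
    then have "(sqrt S)\<^sup>2 \<le> (2 * M)\<^sup>2" using S by (intro power_mono) auto
    then show ?thesis using S by (simp add: S_def[symmetric] power_mult_distrib)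
  qed
qed

text \<open>In the language of operator ideals, the identity of the space is absolutely \<open>(2, 1)\<close>-summing.\<close>

definition orlicz_const :: "'a::real_normed_vector itself \<Rightarrow> real \<Rightarrow> bool" where
  "orlicz_const X K \<longleftrightarrow> (\<forall>n (u :: nat \<Rightarrow> 'a) w.
     (\<forall>\<epsilon>\<in>{..<n} \<rightarrow>\<^sub>E {-1, 1}. norm (\<Sum>i<n. \<epsilon> i *\<^sub>R u i) \<le> w) \<longrightarrow> (\<Sum>i<n. (norm (u i))\<^sup>2) \<le> K * w\<^sup>2)"

text \<open>A double sequence whose \<open>k\<close>-th row vanishes from \<open>n k\<close> on is listed along the pairing function.
  These two lemmas compare the partial sums of the list with the row sums.\<close>

lemma sum_over_prod_decode_le:
  fixes h :: "nat \<times> nat \<Rightarrow> real"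
  assumes nn: "\<And>p. h p \<ge> 0" and z: "\<And>k i. \<not> i < n k \<Longrightarrow> h (k, i) = 0"
  obtains m where "(\<Sum>j<N. h (prod_decode j)) \<le> (\<Sum>k<m. \<Sum>i<n k. h (k, i))"
proof -
  let ?P = "prod_decode ` {..<N}"
  have "finite (fst ` ?P)" by simp
  then obtain m where m: "fst ` ?P \<subseteq> {..<m}" using finite_nat_iff_bounded by blast
  let ?Q = "Sigma {..<m} (\<lambda>k. {..<n k})"
  have "(\<Sum>j<N. h (prod_decode j)) = sum h ?P"
    by (subst sum.reindex) (auto simp: inj_prod_decode)
  also have "\<dots> = sum h (?P \<inter> ?Q)"
  proof (rule sum.mono_neutral_right)
    show "\<forall>p\<in>?P - ?P \<inter> ?Q. h p = 0"
    proof
      fix p assume p: "p \<in> ?P - ?P \<inter> ?Q"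
      obtain k i where ki: "p = (k, i)" by (cases p)
      have "k \<in> fst ` ?P" using p ki by (metis DiffD1 fst_conv imageI)
      then have "k < m" using m by auto
      then have "\<not> i < n k" using p ki by auto
      then show "h p = 0" using z ki by simp
    qed
  qed auto
  also have "\<dots> \<le> sum h ?Q" using nn by (intro sum_mono2) auto
  also have "\<dots> = (\<Sum>k<m. \<Sum>i<n k. h (k, i))" by (subst sum.Sigma) (auto simp: case_prod_unfold)
  finally show ?thesis using that by blast
qed

lemma sum_over_prod_decode_ge:
  fixes h :: "nat \<times> nat \<Rightarrow> real"
  assumes nn: "\<And>p. h p \<ge> 0"
  obtains N where "(\<Sum>k<m. \<Sum>i<n k. h (k, i)) \<le> (\<Sum>j<N. h (prod_decode j))"
proof -
  let ?Q = "Sigma {..<m} (\<lambda>k. {..<n k})"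
  have "finite (prod_encode ` ?Q)" by auto
  then obtain N where N: "prod_encode ` ?Q \<subseteq> {..<N}" using finite_nat_iff_bounded by blast
  have "(\<Sum>k<m. \<Sum>i<n k. h (k, i)) = sum h ?Q" by (subst sum.Sigma) (auto simp: case_prod_unfold)
  also have "\<dots> = (\<Sum>j\<in>prod_encode ` ?Q. h (prod_decode j))"
    by (subst sum.reindex) (auto simp: inj_prod_encode)
  also have "\<dots> \<le> (\<Sum>j<N. h (prod_decode j))" using nn N by (intro sum_mono2) auto
  finally show ?thesis using that by blast
qed

text \<open>If no constant works, there are finite families with weak \<open>1\<close>-norm \<open>2\<^bsup>-k\<^esup>\<close> and with sum of squares
  at least \<open>1\<close>, for every \<open>k\<close>.  Their concatenation is weakly \<open>1\<close>-summable, but its norms are not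
  square summable.  The factor \<open>2\<close> in the last hypothesis leaves room for splitting complex values
  into real and imaginary part.\<close>

lemma dominated_imp_orlicz:
  fixes smul :: "'k::{real_normed_field,banach} \<Rightarrow> 'a::real_normed_vector \<Rightarrow> 'a"
  assumes smul: "normed_scaling smul"
    and dom: "dominated_forms smul 1 = cont_bilinear_forms smul"
    and norming: "\<And>x. \<exists>\<phi>\<in>dual_ball smul. norm x \<le> norm (\<phi> x)"
    and weak: "\<And>\<phi> n (u :: nat \<Rightarrow> 'a) w.
      \<lbrakk>\<phi> \<in> dual_ball smul; \<forall>\<epsilon>\<in>{..<n} \<rightarrow>\<^sub>E {-1, 1}. norm (\<Sum>i<n. \<epsilon> i *\<^sub>R u i) \<le> w\<rbrakk>
      \<Longrightarrow> (\<Sum>i<n. norm (\<phi> (u i))) \<le> 2 * w"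
  shows "\<exists>K\<ge>0. orlicz_const TYPE('a) K"
proof (rule ccontr)
  assume no: "\<not> ?thesis"
  have "\<forall>k::nat. \<exists>n (u :: nat \<Rightarrow> 'a) w.
      (\<forall>\<epsilon>\<in>{..<n} \<rightarrow>\<^sub>E {-1, 1}. norm (\<Sum>i<n. \<epsilon> i *\<^sub>R u i) \<le> w) \<and> 4 ^ k * w\<^sup>2 < (\<Sum>i<n. (norm (u i))\<^sup>2)"
  proof
    fix k :: nat
    have "\<not> orlicz_const TYPE('a) (4 ^ k)" using no by auto
    then show "\<exists>n (u :: nat \<Rightarrow> 'a) w. (\<forall>\<epsilon>\<in>{..<n} \<rightarrow>\<^sub>E {-1, 1}. norm (\<Sum>i<n. \<epsilon> i *\<^sub>R u i) \<le> w) \<and>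
        4 ^ k * w\<^sup>2 < (\<Sum>i<n. (norm (u i))\<^sup>2)"
      unfolding orlicz_const_def by (meson not_le)
  qed
  then obtain n where "\<forall>k::nat. \<exists>(u :: nat \<Rightarrow> 'a) w.
      (\<forall>\<epsilon>\<in>{..<n k} \<rightarrow>\<^sub>E {-1, 1}. norm (\<Sum>i<n k. \<epsilon> i *\<^sub>R u i) \<le> w) \<and> 4 ^ k * w\<^sup>2 < (\<Sum>i<n k. (norm (u i))\<^sup>2)"
    by (rule choice[THEN exE])
  then obtain u where "\<forall>k::nat. \<exists>w. (\<forall>\<epsilon>\<in>{..<n k} \<rightarrow>\<^sub>E {-1, 1}. norm (\<Sum>i<n k. \<epsilon> i *\<^sub>R (u k i :: 'a)) \<le> w)
      \<and> 4 ^ k * w\<^sup>2 < (\<Sum>i<n k. (norm (u k i))\<^sup>2)"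
    by (rule choice[THEN exE])
  then obtain w where uw: "\<forall>k::nat. (\<forall>\<epsilon>\<in>{..<n k} \<rightarrow>\<^sub>E {-1, 1}. norm (\<Sum>i<n k. \<epsilon> i *\<^sub>R (u k i :: 'a)) \<le> w k)
      \<and> 4 ^ k * (w k)\<^sup>2 < (\<Sum>i<n k. (norm (u k i))\<^sup>2)"
    by (rule choice[THEN exE])
  have u: "\<forall>\<epsilon>\<in>{..<n k} \<rightarrow>\<^sub>E {-1, 1}. norm (\<Sum>i<n k. \<epsilon> i *\<^sub>R (u k i :: 'a)) \<le> w k" for k
    using uw by blast
  have big: "4 ^ k * (w k)\<^sup>2 < (\<Sum>i<n k. (norm (u k i))\<^sup>2)" for k
    using uw by blast
  have w: "w k > 0" for k
  proof -
    have "restrict (\<lambda>_. 1) {..<n k} \<in> {..<n k} \<rightarrow>\<^sub>E {-1, 1::real}" by simp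
    then obtain \<epsilon> where \<epsilon>: "\<epsilon> \<in> {..<n k} \<rightarrow>\<^sub>E {-1, 1::real}" by blast
    have "w k \<ge> 0" by (rule order_trans[OF norm_ge_zero bspec[OF u \<epsilon>]])
    moreover have "w k \<noteq> 0"
    proof
      assume w0: "w k = 0"
      have "norm (u k i) \<le> 0" if "i < n k" for i
      proof -
        obtain \<phi> where \<phi>: "\<phi> \<in> dual_ball smul" "norm (u k i) \<le> norm (\<phi> (u k i))"
          using norming by blast
        have "norm (\<phi> (u k i)) \<le> (\<Sum>i<n k. norm (\<phi> (u k i)))"
          using that by (intro member_le_sum) auto
        also have "\<dots> \<le> 0" using weak[OF \<phi>(1) u[of k]] w0 by simp
        finally show ?thesis using \<phi>(2) by simp
      qed
      then have "(\<Sum>i<n k. (norm (u k i))\<^sup>2) = 0" by (intro sum.neutral) auto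
      then show False using big[of k] w0 by simp
    qed
    ultimately show ?thesis by simp
  qed
  \<comment> \<open>rescaled so that all signed sums of the \<open>k\<close>-th row have norm at most \<open>2\<^bsup>-k\<^esup>\<close>\<close>
  define y where "y k i = (if i < n k then (1 / (2 ^ k * w k)) *\<^sub>R u k i else 0)" for k i
  define x where "x j = (case prod_decode j of (k, i) \<Rightarrow> y k i)" for j
  have y_sq: "(\<Sum>i<n k. (norm (y k i))\<^sup>2) \<ge> 1" for k
  proof -
    have "((2::real) ^ k)\<^sup>2 = 4 ^ k" by (simp add: power2_eq_square power_mult_distrib[symmetric])
    then have c: "(1 / (2 ^ k * w k))\<^sup>2 = 1 / (4 ^ k * (w k)\<^sup>2)"
      by (simp add: power_divide power_mult_distrib)
    have "(norm (y k i))\<^sup>2 = (1 / (2 ^ k * w k))\<^sup>2 * (norm (u k i))\<^sup>2" if "i < n k" for i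
      using that by (simp only: y_def if_True norm_scaleR power_mult_distrib power2_abs)
    then have "(\<Sum>i<n k. (norm (y k i))\<^sup>2) = (\<Sum>i<n k. (norm (u k i))\<^sup>2) / (4 ^ k * (w k)\<^sup>2)"
      by (simp add: c sum_divide_distrib)
    moreover have "4 ^ k * (w k)\<^sup>2 > 0" using w[of k] by simp
    ultimately show ?thesis using big[of k] by simp
  qed
  have y_weak: "(\<Sum>i<n k. norm (\<phi> (y k i))) \<le> 2 * (1 / 2) ^ k" if \<phi>: "\<phi> \<in> dual_ball smul" for \<phi> k
  proof -
    have "(\<Sum>i<n k. norm (\<phi> (y k i))) = (1 / (2 ^ k * w k)) * (\<Sum>i<n k. norm (\<phi> (u k i)))"
      using w[of k] by (simp add: y_def dual_ballD[OF \<phi>] sum_distrib_left)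
    also have "\<dots> \<le> (1 / (2 ^ k * w k)) * (2 * w k)"
      using w[of k] by (intro mult_left_mono weak[OF \<phi> u]) auto
    also have "\<dots> = 2 * (1 / 2) ^ k" using w[of k] by (simp add: power_one_over)
    finally show ?thesis .
  qed
  have x_weak: "(\<Sum>j<N. norm (\<phi> (x j))) \<le> 4" if \<phi>: "\<phi> \<in> dual_ball smul" for \<phi> N
  proof -
    have \<phi>0: "\<phi> 0 = 0" using dual_ballD(3)[OF \<phi>, of 0 0] by simp
    obtain m where "(\<Sum>j<N. (\<lambda>(k, i). norm (\<phi> (y k i))) (prod_decode j)) \<le>
        (\<Sum>k<m. \<Sum>i<n k. (\<lambda>(k, i). norm (\<phi> (y k i))) (k, i))"
      by (rule sum_over_prod_decode_le[where h = "\<lambda>(k, i). norm (\<phi> (y k i))" and n = n and N = N])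
         (auto simp: y_def \<phi>0)
    then have "(\<Sum>j<N. norm (\<phi> (x j))) \<le> (\<Sum>k<m. \<Sum>i<n k. norm (\<phi> (y k i)))"
      by (simp add: x_def case_prod_unfold)
    also have "\<dots> \<le> (\<Sum>k<m. 2 * (1 / 2) ^ k)" by (intro sum_mono y_weak[OF \<phi>])
    also have "\<dots> \<le> 2 * (\<Sum>k. (1 / 2) ^ k)"
      by (subst sum_distrib_left[symmetric], intro mult_left_mono sum_le_suminf summable_geometric) auto
    also have "\<dots> = 4" by (simp add: suminf_geometric)
    finally show ?thesis .
  qed
  have "weakly_summable smul 1 x"
    unfolding weakly_summable_def
  proof (intro conjI ballI)
    fix \<phi> assume \<phi>: "\<phi> \<in> dual_ball smul"
    show "summable (\<lambda>j. norm (\<phi> (x j)) powr 1)"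
      using summableI_nonneg_bounded[OF _ x_weak[OF \<phi>]] by simp
  next
    show "bdd_above ((\<lambda>\<phi>. (\<Sum>j. norm (\<phi> (x j)) powr 1) powr (1 / 1)) ` dual_ball smul)"
    proof (rule bdd_aboveI2)
      fix \<phi> assume \<phi>: "\<phi> \<in> dual_ball smul"
      have s: "summable (\<lambda>j. norm (\<phi> (x j)))"
        using summableI_nonneg_bounded[OF _ x_weak[OF \<phi>]] by simp
      then have "(\<Sum>j. norm (\<phi> (x j))) \<le> 4" by (intro suminf_le_const x_weak[OF \<phi>])
      then show "(\<Sum>j. norm (\<phi> (x j)) powr 1) powr (1 / 1) \<le> 4"
        using suminf_nonneg[OF s] by simp
    qed
  qed
  from dominated_imp_bounded_on_ball[OF smul dom this]
  obtain M where M: "\<And>F n. \<lbrakk>F \<in> scalar_bilinear smul; norm F \<le> 1\<rbrakk>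
      \<Longrightarrow> (\<Sum>j<n. sqrt (norm (F (x j) (x j)))) \<le> M" by metis
  obtain m :: nat where m: "4 * M\<^sup>2 < real m" using reals_Archimedean2 by blast
  obtain N where "(\<Sum>k<m. \<Sum>i<n k. (\<lambda>(k, i). (norm (y k i))\<^sup>2) (k, i)) \<le>
      (\<Sum>j<N. (\<lambda>(k, i). (norm (y k i))\<^sup>2) (prod_decode j))"
    by (rule sum_over_prod_decode_ge[where h = "\<lambda>(k, i). (norm (y k i))\<^sup>2" and n = n and m = m]) auto
  then have "(\<Sum>k<m. \<Sum>i<n k. (norm (y k i))\<^sup>2) \<le> (\<Sum>j<N. (norm (x j))\<^sup>2)"
    by (simp add: x_def case_prod_unfold)
  also have "\<dots> \<le> 4 * M\<^sup>2" by (rule sum_norm_sq_le_of_bounded_on_ball[OF norming M])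
  finally have "(\<Sum>k<m. \<Sum>i<n k. (norm (y k i))\<^sup>2) < real m" using m by linarith
  moreover have "(\<Sum>k<m. 1) \<le> (\<Sum>k<m. \<Sum>i<n k. (norm (y k i))\<^sup>2)" by (intro sum_mono y_sq)
  ultimately show False by simp
qed

text \<open>The weak \<open>1\<close>-norm of a finite family is controlled by its signed sums: choose the signs of the
  values of the functional.\<close>

lemma sum_abs_functional_le:
  assumes f: "linear f" "\<And>v. \<bar>f v\<bar> \<le> norm v"
    and u: "\<forall>\<epsilon>\<in>{..<n} \<rightarrow>\<^sub>E {-1, 1}. norm (\<Sum>i<n. \<epsilon> i *\<^sub>R u i) \<le> w"
  shows "(\<Sum>i<n. \<bar>f (u i)\<bar>) \<le> w"
proof -
  let ?\<epsilon> = "restrict (\<lambda>i. if f (u i) \<ge> 0 then 1 else -1 :: real) {..<n}"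
  have "(\<Sum>i<n. \<bar>f (u i)\<bar>) = (\<Sum>i<n. ?\<epsilon> i * f (u i))" by (intro sum.cong) auto
  also have "\<dots> = f (\<Sum>i<n. ?\<epsilon> i *\<^sub>R u i)" using f(1) by (simp add: linear_sum linear_cmul)
  also have "\<dots> \<le> norm (\<Sum>i<n. ?\<epsilon> i *\<^sub>R u i)" using f(2) abs_le_D1 by blast
  also have "\<dots> \<le> w" by (rule bspec[OF u], rule PiE_I) simp_all
  finally show ?thesis .
qed

section \<open>Large averages inside long sequences\<close>

text \<open>Ramsey's theorem for the colourings of the \<open>l\<close>-subsets of an arbitrary large set of numbers.\<close>

lemma ramsey_on_finite_sets:
  "\<exists>M::nat. \<forall>(V :: nat set) (f :: nat set \<Rightarrow> nat). finite V \<and> M \<le> card V \<and> (\<forall>S\<in>nsets V l. f S < q) \<longrightarrow>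
     (\<exists>H i. H \<in> nsets V L \<and> (\<forall>S\<in>nsets H l. f S = i))"
proof -
  obtain M :: nat where M: "partn_lst {..<M} (replicate q L) l" using ramsey_full by blast
  show ?thesis
  proof (intro exI[of _ M] allI impI, elim conjE)
    fix V :: "nat set" and f :: "nat set \<Rightarrow> nat"
    assume V: "finite V" "M \<le> card V" and f: "\<forall>S\<in>nsets V l. f S < q"
    obtain e where e: "bij_betw e {..<card V} V"
      using ex_bij_betw_nat_finite[OF V(1)] by (auto simp: atLeast0LessThan)
    then have inj: "inj_on e {..<card V}" and im: "e ` {..<card V} = V" by (auto simp: bij_betw_def)
    have img: "e ` T \<in> nsets V r" if "T \<in> nsets {..<card V} r" for T r
    proof -
      have "inj_on e T" by (rule inj_on_subset[OF inj]) (use that in \<open>auto simp: nsets_def\<close>)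
      then show ?thesis using that im by (auto simp: nsets_def card_image)
    qed
    have "(\<lambda>T. f (e ` T)) \<in> nsets {..<card V} l \<rightarrow> {..<q}" using f img by auto
    then obtain i H' where i: "i < length (replicate q L)" and "H' \<in> nsets {..<card V} (replicate q L ! i)"
        "(\<lambda>T. f (e ` T)) ` nsets H' l \<subseteq> {i}"
      by (rule partn_lstE[OF partn_lst_greater_resource[OF M V(2)]]) simp
    then have H': "H' \<in> nsets {..<card V} L" "(\<lambda>T. f (e ` T)) ` nsets H' l \<subseteq> {i}"
      by simp_all
    have "f S = i" if S: "S \<in> nsets (e ` H') l" for S
    proof -
      obtain T where T: "T \<subseteq> H'" "S = e ` T" using S by (auto simp: nsets_def subset_image_iff)
      have "inj_on e T" by (rule inj_on_subset[OF inj]) (use T H' in \<open>auto simp: nsets_def\<close>)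
      then have "T \<in> nsets H' l"
        using T S H' by (auto simp: nsets_def card_image intro: finite_subset)
      then show ?thesis using H'(2) T by auto
    qed
    then show "\<exists>H i. H \<in> nsets V L \<and> (\<forall>S\<in>nsets H l. f S = i)" using img[OF H'(1)] by blast
  qed
qed

text \<open>For any signs \<open>\<sigma>\<close>, the sum of the \<open>\<sigma>\<^sub>i (x(a\<^sub>i) - x(b\<^sub>i))\<close> is the difference of two sums over
  transversals with the same pattern \<open>\<epsilon>\<close>: exchange \<open>a\<^sub>i\<close> and \<open>b\<^sub>i\<close> wherever \<open>\<sigma>\<close> differs from
  \<open>\<epsilon>\<close>.  A bound for a single pattern thus becomes a bound for all of them.\<close>

lemma orlicz_transversals:
  fixes x :: "'i \<Rightarrow> 'a::real_normed_vector"
    and l :: nat and \<epsilon> :: "nat \<Rightarrow> real" and C :: "nat \<Rightarrow> 'i set" and a b :: "nat \<Rightarrow> 'i" and \<delta> \<rho> K :: real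
  assumes K: "orlicz_const TYPE('a) K"
    and \<epsilon>: "\<epsilon> \<in> {..<l} \<rightarrow>\<^sub>E {-1, 1}"
    and trans: "\<And>c. (\<And>i. i < l \<Longrightarrow> c i \<in> C i) \<Longrightarrow> norm (\<Sum>i<l. \<epsilon> i *\<^sub>R x (c i)) \<le> \<rho>"
    and ab: "\<And>i. i < l \<Longrightarrow> a i \<in> C i" "\<And>i. i < l \<Longrightarrow> b i \<in> C i"
    and far: "\<And>i. i < l \<Longrightarrow> \<delta> \<le> norm (x (a i) - x (b i))" and \<delta>: "\<delta> \<ge> 0"
  shows "real l * \<delta>\<^sup>2 \<le> K * (2 * \<rho>)\<^sup>2"
proof -
  let ?u = "\<lambda>i. x (a i) - x (b i)"
  have "norm (\<Sum>i<l. \<sigma> i *\<^sub>R ?u i) \<le> 2 * \<rho>" if \<sigma>: "\<sigma> \<in> {..<l} \<rightarrow>\<^sub>E {-1, 1}" for \<sigma>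
  proof -
    let ?c = "\<lambda>i. if \<sigma> i = \<epsilon> i then a i else b i"
    let ?d = "\<lambda>i. if \<sigma> i = \<epsilon> i then b i else a i"
    have "\<sigma> i *\<^sub>R ?u i = \<epsilon> i *\<^sub>R x (?c i) - \<epsilon> i *\<^sub>R x (?d i)" if "i < l" for i
    proof -
      have "\<sigma> i \<in> {-1, 1}" by (rule PiE_mem[OF \<sigma>]) (simp add: that)
      moreover have "\<epsilon> i \<in> {-1, 1}" by (rule PiE_mem[OF \<epsilon>]) (simp add: that)
      ultimately have "\<sigma> i = \<epsilon> i \<or> \<sigma> i \<noteq> \<epsilon> i \<and> \<sigma> i = - \<epsilon> i" by force
      then show ?thesis by (elim disjE conjE) (simp_all add: scaleR_diff_right)
    qed
    then have "(\<Sum>i<l. \<sigma> i *\<^sub>R ?u i) = (\<Sum>i<l. \<epsilon> i *\<^sub>R x (?c i)) - (\<Sum>i<l. \<epsilon> i *\<^sub>R x (?d i))"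
      unfolding sum_subtractf[symmetric] by (intro sum.cong) auto
    also have "norm \<dots> \<le> norm (\<Sum>i<l. \<epsilon> i *\<^sub>R x (?c i)) + norm (\<Sum>i<l. \<epsilon> i *\<^sub>R x (?d i))"
      by (rule norm_triangle_ineq4)
    also have "\<dots> \<le> \<rho> + \<rho>" by (intro add_mono trans) (simp_all add: ab)
    finally show ?thesis by simp
  qed
  then have "(\<Sum>i<l. (norm (?u i))\<^sup>2) \<le> K * (2 * \<rho>)\<^sup>2"
    by (intro K[unfolded orlicz_const_def, rule_format])
  moreover have "(\<Sum>i<l. \<delta>\<^sup>2) \<le> (\<Sum>i<l. (norm (?u i))\<^sup>2)"
    by (intro sum_mono power_mono) (simp_all add: far \<delta>)
  ultimately show ?thesis by simp
qed

text \<open>On vectors that are close to \<open>x s\<close>, the functional that norms \<open>x s\<close> is at least \<open>\<mu> / 2\<close>.\<close>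

lemma rad_ge_of_clustered:
  fixes x :: "nat \<Rightarrow> 'a::real_normed_vector"
  assumes U: "finite U" "S \<subseteq> U" and s: "\<mu> \<le> norm (x s)" "\<mu> \<ge> 0"
    and close: "\<And>j. j \<in> S \<Longrightarrow> norm (x j - x s) \<le> \<mu> / 2"
  shows "card S * (\<mu> / 2)\<^sup>2 \<le> rad U S x"
proof -
  obtain f :: "'a \<Rightarrow> real" where f: "linear f" "\<And>v. \<bar>f v\<bar> \<le> norm v" "f (x s) = norm (x s)"
    using real_norming_functional by blast
  have "\<mu> / 2 \<le> f (x j)" if "j \<in> S" for j
  proof -
    have "f (x j) = f (x s) + f (x j - x s)" using f(1) by (simp add: linear_diff)
    then show ?thesis using f(2)[of "x j - x s"] f(3) s close[OF that] by linarith
  qed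
  then have "(\<Sum>j\<in>S. (\<mu> / 2)\<^sup>2) \<le> (\<Sum>j\<in>S. (f (x j))\<^sup>2)"
    using s by (intro sum_mono power_mono) auto
  also have "\<dots> \<le> rad U S x" by (rule sum_sq_functional_le_rad[OF f(1,2) U])
  finally show ?thesis by simp
qed

lemma sorted_list_of_image:
  fixes s :: "nat \<Rightarrow> nat"
  assumes "strict_mono_on {..<l} s"
  shows "sorted_list_of_set (s ` {..<l}) = map s [0..<l]"
proof -
  have "sorted_wrt (<) (map s [0..<l])"
    using assms by (auto simp: sorted_wrt_iff_nth_less strict_mono_on_def)
  then have "sorted (map s [0..<l])" "distinct (map s [0..<l])"
    by (auto simp: strict_sorted_iff)
  moreover have "s ` {..<l} = set (map s [0..<l])" by (simp add: atLeast0LessThan)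
  ultimately show ?thesis by (metis sorted_list_of_set.idem_if_sorted_distinct)
qed

text \<open>The step from suprema over signs to means over signs.  It matters that the constant
  \<open>16 (K + 1)\<close> does not depend on \<open>l\<close>.\<close>

lemma large_rad_subset:
  assumes K: "orlicz_const TYPE('a::real_normed_vector) K" "K \<ge> 0" and l: "(l::nat) \<ge> 1"
  shows "\<exists>M::nat. \<forall>(U :: nat set) V (\<mu> :: real) (x :: nat \<Rightarrow> 'a).
    finite U \<and> V \<subseteq> U \<and> M \<le> card V \<and> \<mu> > 0 \<and> (\<forall>j\<in>V. \<mu> \<le> norm (x j)) \<longrightarrow>
    (\<exists>S\<subseteq>V. card S = l \<and> real l * \<mu>\<^sup>2 / (16 * (K + 1)) \<le> rad U S x)"
proof -
  let ?P = "{..<l} \<rightarrow>\<^sub>E {-1, 1::real}"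
  have finP: "finite ?P" by (intro finite_PiE) auto
  then obtain g where g: "bij_betw g ?P {..<card ?P}"
    using ex_bij_betw_finite_nat by (metis atLeast0LessThan)
  from ramsey_on_finite_sets[of l "Suc (card ?P)" "l * l"]
  obtain M :: nat where M: "\<forall>(V :: nat set) f. finite V \<and> M \<le> card V \<and> (\<forall>S\<in>nsets V l. f S < Suc (card ?P)) \<longrightarrow>
     (\<exists>H i. H \<in> nsets V (l * l) \<and> (\<forall>S\<in>nsets H l. f S = i))"
    by (rule exE)
  show ?thesis
  proof (intro exI[of _ M] allI impI, elim conjE, rule ccontr)
    fix U V :: "nat set" and \<mu> :: real and x :: "nat \<Rightarrow> 'a"
    assume U: "finite U" "V \<subseteq> U" and V: "M \<le> card V" and \<mu>: "\<mu> > 0"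
      and big: "\<forall>j\<in>V. \<mu> \<le> norm (x j)"
      and no: "\<not> (\<exists>S\<subseteq>V. card S = l \<and> real l * \<mu>\<^sup>2 / (16 * (K + 1)) \<le> rad U S x)"
    define r where "r = real l * \<mu>\<^sup>2 / (16 * (K + 1))"
    have r0: "r > 0" using l \<mu> K by (simp add: r_def)
    have small: "rad U S x < r" if "S \<in> nsets V l" for S
      using no that by (auto simp: nsets_def r_def not_le)
    have finV: "finite V" using U finite_subset by blast
    define en where "en S i = sorted_list_of_set S ! i" for S :: "nat set" and i
    have pat: "\<exists>\<epsilon>\<in>?P. (norm (\<Sum>i<l. \<epsilon> i *\<^sub>R x (en S i)))\<^sup>2 \<le> r" if S: "S \<in> nsets V l" for S
    proof -
      have SU: "S \<subseteq> U" "finite S" "card S = l" using S U by (auto simp: nsets_def)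
      obtain \<eta> where \<eta>: "\<eta> \<in> U \<rightarrow>\<^sub>E {-1, 1}" "(norm (\<Sum>j\<in>S. \<eta> j *\<^sub>R x j))\<^sup>2 \<le> rad U S x"
        using exists_signs_le_rad[OF U(1), where S = S and x = x] by blast
      have en: "bij_betw (en S) {..<l} S"
        unfolding en_def[abs_def] using SU by (intro bij_betw_nth) auto
      let ?\<epsilon> = "restrict (\<lambda>i. \<eta> (en S i)) {..<l}"
      have "?\<epsilon> \<in> ?P"
      proof (rule PiE_I)
        fix i assume i: "i \<in> {..<l}"
        then have "en S i \<in> U" using bij_betwE[OF en] SU(1) by blast
        then show "?\<epsilon> i \<in> {-1, 1}" using PiE_mem[OF \<eta>(1)] i by simp
      qed simp
      moreover have "(\<Sum>i<l. ?\<epsilon> i *\<^sub>R x (en S i)) = (\<Sum>j\<in>S. \<eta> j *\<^sub>R x j)"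
        unfolding sum.reindex_bij_betw[OF en, of "\<lambda>j. \<eta> j *\<^sub>R x j", symmetric]
        by (rule sum.cong) simp_all
      ultimately show ?thesis using \<eta>(2) small[OF S] by (intro bexI[of _ ?\<epsilon>]) auto
    qed
    \<comment> \<open>the colour of an \<open>l\<close>-subset is a pattern of signs that makes the sum small when its elements are listed in increasing order\<close>
    define pt where "pt S = (SOME \<epsilon>. \<epsilon> \<in> ?P \<and> (norm (\<Sum>i<l. \<epsilon> i *\<^sub>R x (en S i)))\<^sup>2 \<le> r)" for S
    have pt: "pt S \<in> ?P" "(norm (\<Sum>i<l. pt S i *\<^sub>R x (en S i)))\<^sup>2 \<le> r" if "S \<in> nsets V l" for S
      using someI_ex[OF pat[OF that, unfolded Bex_def]] by (simp_all only: pt_def)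
    have "g (pt S) < Suc (card ?P)" if "S \<in> nsets V l" for S
      using pt(1)[OF that] bij_betwE[OF g] by (simp add: less_Suc_eq)
    then have "\<exists>H i. H \<in> nsets V (l * l) \<and> (\<forall>S\<in>nsets H l. g (pt S) = i)"
      using spec[OF spec[OF M, of V], of "\<lambda>S. g (pt S)"] finV V by simp
    then obtain H c where H: "H \<in> nsets V (l * l)" and hom: "\<forall>S\<in>nsets H l. g (pt S) = c"
      by (elim exE conjE)
    have HV: "H \<subseteq> V" "finite H" "card H = l * l" using H by (auto simp: nsets_def)
    have sub: "S \<in> nsets V l" if "S \<in> nsets H l" for S using that HV by (auto simp: nsets_def)
    define h where "h i = sorted_list_of_set H ! i" for i
    have h_mono: "h i < h j" if "i < j" "j < l * l" for i j
      unfolding h_def using that HV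
      by (intro sorted_wrt_nth_less[OF strict_sorted_list_of_set[of H]]) simp_all
    have hH: "h i \<in> H" if "i < l * l" for i
      unfolding h_def using that HV by (metis length_sorted_list_of_set nth_mem set_sorted_list_of_set)
    have idx: "i * l + t < l * l" if "i < l" "t < l" for i t
    proof -
      have "i * l + t < Suc i * l" using that by simp
      also have "\<dots> \<le> l * l" using that by (intro mult_le_mono) auto
      finally show ?thesis .
    qed
    \<comment> \<open>the \<open>i\<close>-th of \<open>l\<close> consecutive cells of \<open>H\<close>, so that every transversal is listed in the order of the cells\<close>
    define C where "C i = (\<lambda>t. h (i * l + t)) ` {..<l}" for i
    have C_less: "a < b" if ab: "a \<in> C i" "b \<in> C j" and ij: "i < j" "j < l" for a b i j
    proof -
      obtain t s where ts: "a = h (i * l + t)" "t < l" "b = h (j * l + s)" "s < l"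
        using ab by (auto simp: C_def)
      have "i * l + t < Suc i * l" using ts by simp
      also have "\<dots> \<le> j * l" using ij by (intro mult_le_mono) auto
      finally show ?thesis using ts idx[OF \<open>j < l\<close> ts(4)] by (auto intro: h_mono)
    qed
    have CH: "C i \<subseteq> H" if "i < l" for i using that hH idx by (auto simp: C_def)
    have Cn: "C i \<in> nsets H l" if "i < l" for i
    proof -
      have "inj_on (\<lambda>t. h (i * l + t)) {..<l}"
      proof (rule linorder_inj_onI)
        fix t s assume "t < s" "t \<in> {..<l}" "s \<in> {..<l}"
        then have "h (i * l + t) < h (i * l + s)" using that idx by (intro h_mono) auto
        then show "h (i * l + t) \<noteq> h (i * l + s)" by simp
      qed auto
      then show ?thesis using CH[OF that] by (auto simp: nsets_def C_def card_image)
    qed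
    let ?\<epsilon> = "pt (C 0)"
    have C0: "C 0 \<in> nsets H l" using Cn l by simp
    have trans: "norm (\<Sum>i<l. ?\<epsilon> i *\<^sub>R x (c i)) \<le> sqrt r" if c: "\<And>i. i < l \<Longrightarrow> c i \<in> C i" for c
    proof -
      have mono: "strict_mono_on {..<l} c"
        by (rule strict_mono_onI) (auto intro!: C_less[OF c c])
      let ?S = "c ` {..<l}"
      have "?S \<subseteq> H" using c CH by auto
      moreover have "card ?S = l" using mono by (simp add: card_image strict_mono_on_imp_inj_on)
      ultimately have S: "?S \<in> nsets H l" by (simp add: nsets_def)
      have "g (pt ?S) = g ?\<epsilon>" using hom S C0 by simp
      then have "pt ?S = ?\<epsilon>"
        using g pt(1)[OF sub[OF S]] pt(1)[OF sub[OF C0]] by (metis bij_betw_inv_into_left)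
      moreover have "en ?S i = c i" if "i < l" for i
        using that by (simp add: en_def sorted_list_of_image[OF mono])
      ultimately have "(norm (\<Sum>i<l. ?\<epsilon> i *\<^sub>R x (c i)))\<^sup>2 \<le> r" using pt(2)[OF sub[OF S]] by simp
      then show ?thesis by (rule real_le_rsqrt)
    qed
    show False
    proof (cases "\<forall>i<l. \<exists>a\<in>C i. \<exists>b\<in>C i. \<mu> / 2 \<le> norm (x a - x b)")
      case True
      then obtain a b where ab: "\<And>i. i < l \<Longrightarrow> a i \<in> C i" "\<And>i. i < l \<Longrightarrow> b i \<in> C i"
          "\<And>i. i < l \<Longrightarrow> \<mu> / 2 \<le> norm (x (a i) - x (b i))" by metis
      have "real l * (\<mu> / 2)\<^sup>2 \<le> K * (2 * sqrt r)\<^sup>2"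
        using \<mu> by (intro orlicz_transversals[OF K(1) pt(1)[OF sub[OF C0]] trans ab]) auto
      also have "\<dots> = 4 * K * r" using r0 by (simp add: power_mult_distrib)
      also have "\<dots> = real l * (\<mu> / 2)\<^sup>2 * (K / (K + 1))"
      proof -
        have "K + 1 \<noteq> 0" using K(2) by simp
        then show ?thesis unfolding r_def by (simp add: power_divide divide_simps)
      qed
      also have "\<dots> < real l * (\<mu> / 2)\<^sup>2 * 1" using K l \<mu> by (intro mult_strict_left_mono) auto
      finally show False by simp
    next
      case False
      then obtain i where i: "i < l" "\<And>a b. a \<in> C i \<Longrightarrow> b \<in> C i \<Longrightarrow> norm (x a - x b) < \<mu> / 2"
        by (meson not_le)
      have Ci: "C i \<in> nsets V l" using sub Cn i by blast
      then obtain s where s: "s \<in> C i" using l by (fastforce simp: nsets_def)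
      have "real (card (C i)) * (\<mu> / 2)\<^sup>2 \<le> rad U (C i) x"
        using U Ci big s i \<mu> by (intro rad_ge_of_clustered[where s = s]) (auto simp: nsets_def less_imp_le)
      also have "\<dots> < r" by (rule small[OF Ci])
      also have "r \<le> real l * (\<mu> / 2)\<^sup>2"
        using K l \<mu> by (simp add: r_def power_divide field_simps)
      finally show False using Ci by (simp add: nsets_def)
    qed
  qed
qed

section \<open>Growth of the cotype 2 constants\<close>

lemma greedy_packing:
  assumes V: "finite V" and P: "\<And>S. P S \<Longrightarrow> S \<noteq> {}"
  shows "\<exists>\<S>. (\<forall>S\<in>\<S>. S \<subseteq> V \<and> P S) \<and> pairwise disjnt \<S> \<and> (\<forall>S\<subseteq>V - \<Union>\<S>. \<not> P S)"
  using V
proof (induction V rule: finite_psubset_induct)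
  case (psubset V)
  show ?case
  proof (cases "\<exists>S\<subseteq>V. P S")
    case False
    then show ?thesis by (intro exI[of _ "{}"]) auto
  next
    case True
    then obtain S where S: "S \<subseteq> V" "P S" by blast
    then have "V - S \<subset> V" using P by blast
    from psubset.IH[OF this] obtain \<S> where IH: "\<forall>T\<in>\<S>. T \<subseteq> V - S \<and> P T" "pairwise disjnt \<S>"
        "\<forall>T\<subseteq>V - S - \<Union>\<S>. \<not> P T" by blast
    have "pairwise disjnt (insert S \<S>)"
      using IH(1,2) by (auto simp: pairwise_insert disjnt_def)
    moreover have "V - \<Union>(insert S \<S>) = V - S - \<Union>\<S>" by auto
    ultimately show ?thesis
      using IH S by (intro exI[of _ "insert S \<S>"]) auto
  qed
qed

text \<open>Removing the top level halves the maximum, so the bounds for the successive levels form a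
  geometric series with ratio \<open>1/4\<close>.\<close>

lemma sum_sq_le_of_dyadic_levels:
  fixes a :: "'i \<Rightarrow> real"
  assumes "finite W" and nn: "\<And>j. a j \<ge> 0"
    and "\<And>r. r > 0 \<Longrightarrow> card {j \<in> W. r / 2 < a j \<and> a j \<le> r} \<le> M"
    and "\<And>j. j \<in> W \<Longrightarrow> a j \<le> R"
  shows "(\<Sum>j\<in>W. (a j)\<^sup>2) \<le> 4 / 3 * real M * R\<^sup>2"
  using assms(1,3,4)
proof (induction W arbitrary: R rule: finite_psubset_induct)
  case (psubset W)
  show ?case
  proof (cases "\<exists>j\<in>W. a j > 0")
    case False
    then have "a j = 0" if "j \<in> W" for j using nn[of j] that by force
    then have "(\<Sum>j\<in>W. (a j)\<^sup>2) = 0" by simp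
    then show ?thesis by simp
  next
    case True
    define m where "m = Max (a ` W)"
    have le_m: "a j \<le> m" if "j \<in> W" for j using that psubset.hyps by (simp add: m_def)
    have "m \<in> a ` W" unfolding m_def using True psubset.hyps by (intro Max_in) auto
    then obtain t where t: "t \<in> W" "a t = m" by blast
    have m0: "m > 0" using True le_m by force
    have mR: "m \<le> R" using psubset.prems(2)[of t] t by simp
    let ?T = "{j \<in> W. m / 2 < a j \<and> a j \<le> m}"
    have "t \<in> ?T" using t m0 by simp
    then have sub: "W - ?T \<subset> W" using t by blast
    have "(\<Sum>j\<in>W - ?T. (a j)\<^sup>2) \<le> 4 / 3 * real M * (m / 2)\<^sup>2"
    proof (rule psubset.IH[OF sub])
      fix r :: real assume "r > 0"
      have "card {j \<in> W - ?T. r / 2 < a j \<and> a j \<le> r} \<le> card {j \<in> W. r / 2 < a j \<and> a j \<le> r}"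
        using psubset.hyps by (intro card_mono) auto
      also have "\<dots> \<le> M" by (rule psubset.prems(1)[OF \<open>r > 0\<close>])
      finally show "card {j \<in> W - ?T. r / 2 < a j \<and> a j \<le> r} \<le> M" .
    qed (use le_m in force)
    moreover have "(\<Sum>j\<in>?T. (a j)\<^sup>2) \<le> real M * m\<^sup>2"
    proof -
      have "(\<Sum>j\<in>?T. (a j)\<^sup>2) \<le> real (card ?T) * m\<^sup>2"
        using nn by (intro sum_bounded_above power_mono) auto
      also have "\<dots> \<le> real M * m\<^sup>2" using psubset.prems(1)[OF m0] by (intro mult_right_mono) auto
      finally show ?thesis .
    qed
    moreover have "(\<Sum>j\<in>W. (a j)\<^sup>2) = (\<Sum>j\<in>W - ?T. (a j)\<^sup>2) + (\<Sum>j\<in>?T. (a j)\<^sup>2)"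
      using psubset.hyps by (intro sum.subset_diff) auto
    ultimately have "(\<Sum>j\<in>W. (a j)\<^sup>2) \<le> 4 / 3 * (real M * m\<^sup>2)" by (simp add: power_divide)
    also have "\<dots> \<le> 4 / 3 * (real M * R\<^sup>2)" using m0 mR by (intro mult_left_mono power_mono) auto
    finally show ?thesis by simp
  qed
qed

definition cotype2_bound :: "'a::real_normed_vector itself \<Rightarrow> nat \<Rightarrow> real \<Rightarrow> bool" where
  "cotype2_bound X n D \<longleftrightarrow>
     (\<forall>y :: nat \<Rightarrow> 'a. (\<Sum>b<n. (norm (y b))\<^sup>2) \<le> D * (rademacher_mean n y)\<^sup>2)"

lemma sum_rad_family_le:
  fixes x :: "nat \<Rightarrow> 'a::real_normed_vector"
  assumes cb: "cotype2_bound TYPE('a) m D" and D: "D \<ge> 0" and U: "finite U"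
    and \<S>: "\<And>S. S \<in> \<S> \<Longrightarrow> S \<subseteq> U" "pairwise disjnt \<S>" "finite \<S>" "card \<S> \<le> m"
  shows "(\<Sum>S\<in>\<S>. rad U S x) \<le> D * rad U U x"
proof -
  obtain e where e: "bij_betw e {..<card \<S>} \<S>"
    using ex_bij_betw_nat_finite[OF \<S>(3)] by (auto simp: atLeast0LessThan)
  have inj: "inj_on e {..<card \<S>}" and mem: "\<And>b. b < card \<S> \<Longrightarrow> e b \<in> \<S>"
    using e by (auto simp: bij_betw_def)
  let ?S = "\<lambda>b. if b < card \<S> then e b else {}"
  have "(\<Sum>b<m. rad U (?S b) x) \<le> D * rad U U x"
  proof (rule sum_rad_blocks_le[OF U])
    show "?S b \<subseteq> U" if "b < m" for b using \<S>(1) mem by auto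
    show "?S b \<inter> ?S c = {}" if "b < m" "c < m" "b \<noteq> c" for b c
    proof (cases "b < card \<S> \<and> c < card \<S>")
      case True
      then have "e b \<noteq> e c" using that inj by (auto dest: inj_onD)
      then have "disjnt (e b) (e c)" using True mem \<S>(2) by (auto dest: pairwiseD)
      then show ?thesis using True by (simp add: disjnt_def)
    qed auto
    show "(\<Sum>b<m. (norm (y b))\<^sup>2) \<le> D * (rademacher_mean m y)\<^sup>2" for y :: "nat \<Rightarrow> 'a"
      using cb by (simp add: cotype2_bound_def)
  qed (rule D)
  moreover have "(\<Sum>S\<in>\<S>. rad U S x) = (\<Sum>b<card \<S>. rad U (?S b) x)"
    by (subst sum.reindex_bij_betw[OF e, symmetric]) simp
  moreover have "\<dots> \<le> (\<Sum>b<m. rad U (?S b) x)"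
    using \<S>(4) by (intro sum_mono2) (auto simp: rad_nonneg)
  ultimately show ?thesis by linarith
qed

text \<open>The preceding inequality for blocks that are singletons.\<close>

lemma sum_norm_sq_subset_le:
  fixes x :: "nat \<Rightarrow> 'a::real_normed_vector"
  assumes cb: "cotype2_bound TYPE('a) m D" and D: "D \<ge> 0" and U: "finite U"
    and S: "S \<subseteq> U" "card S \<le> m"
  shows "(\<Sum>j\<in>S. (norm (x j))\<^sup>2) \<le> D * rad U U x"
proof -
  have fin: "finite S" using U S finite_subset by blast
  have "(\<Sum>j\<in>S. (norm (x j))\<^sup>2) = (\<Sum>j\<in>S. rad U {j} x)"
    using S U by (intro sum.cong) (auto simp: rad_singleton)
  also have "\<dots> = (\<Sum>T\<in>(\<lambda>j. {j}) ` S. rad U T x)" by (subst sum.reindex) auto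
  also have "\<dots> \<le> D * rad U U x"
    using S fin by (intro sum_rad_family_le[OF cb D U])
      (auto simp: card_image pairwise_def disjnt_def)
  finally show ?thesis .
qed

lemma cotype2_bound_mono:
  assumes cb: "cotype2_bound TYPE('a::real_normed_vector) m D" and "D \<ge> 0" "n \<le> m" "D \<le> E"
  shows "cotype2_bound TYPE('a) n E"
  unfolding cotype2_bound_def
proof
  fix y :: "nat \<Rightarrow> 'a"
  have "(\<Sum>b<n. (norm (y b))\<^sup>2) \<le> D * rad {..<n} {..<n} y"
    using assms by (intro sum_norm_sq_subset_le[OF cb]) auto
  also have "\<dots> \<le> E * rad {..<n} {..<n} y"
    using assms by (intro mult_right_mono rad_nonneg) auto
  finally show "(\<Sum>b<n. (norm (y b))\<^sup>2) \<le> E * (rademacher_mean n y)\<^sup>2"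
    by (simp add: rademacher_mean_sq)
qed

text \<open>The multiplicative constant does not depend on \<open>l\<close>; only the additive one does.\<close>

lemma cotype2_bound_times:
  assumes K: "orlicz_const TYPE('a::real_normed_vector) K" "K \<ge> 0" and l: "(l::nat) \<ge> 1"
  shows "\<exists>M::nat. \<forall>m D. cotype2_bound TYPE('a) m D \<and> D \<ge> 0 \<longrightarrow>
     cotype2_bound TYPE('a) (l * m) (64 * (K + 1) * D + 2 * real M)"
proof -
  from large_rad_subset[OF K l]
  obtain M :: nat where M: "\<forall>(U :: nat set) V (\<mu> :: real) (x :: nat \<Rightarrow> 'a).
    finite U \<and> V \<subseteq> U \<and> M \<le> card V \<and> \<mu> > 0 \<and> (\<forall>j\<in>V. \<mu> \<le> norm (x j)) \<longrightarrow>
    (\<exists>S\<subseteq>V. card S = l \<and> real l * \<mu>\<^sup>2 / (16 * (K + 1)) \<le> rad U S x)"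
    by (rule exE)
  show ?thesis
  proof (intro exI[of _ M] allI impI, elim conjE)
    fix m D assume cb: "cotype2_bound TYPE('a) m D" and D: "(D::real) \<ge> 0"
    show "cotype2_bound TYPE('a) (l * m) (64 * (K + 1) * D + 2 * real M)"
      unfolding cotype2_bound_def
    proof
      fix x :: "nat \<Rightarrow> 'a"
      define U where "U = {..<l * m}"
      have U: "finite U" "card U = l * m" by (simp_all add: U_def)
      define r where "r = rad U U x"
      have r0: "r \<ge> 0" by (simp add: r_def rad_nonneg)
      \<comment> \<open>the norms in a block admitted here are dominated by its signed sums; the greedy choice exhausts such blocks\<close>
      define P where "P S \<longleftrightarrow> card S = l \<and> (\<Sum>j\<in>S. (norm (x j))\<^sup>2) \<le> 64 * (K + 1) * rad U S x" for S
      have Pne: "S \<noteq> {}" if "P S" for S using that l by (auto simp: P_def)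
      obtain \<S> where \<S>: "\<forall>S\<in>\<S>. S \<subseteq> U \<and> P S" "pairwise disjnt \<S>" "\<forall>S\<subseteq>U - \<Union>\<S>. \<not> P S"
        using greedy_packing[of U P, OF U(1) Pne] by blast
      have fin: "finite \<S>" using \<S>(1) U(1) by (intro finite_subset[of \<S> "Pow U"]) auto
      have finS: "finite S" if "S \<in> \<S>" for S using \<S>(1) U(1) that finite_subset by blast
      have "(\<Sum>S\<in>\<S>. l) = card (\<Union>\<S>)"
        using \<S> finS by (subst card_Union_disjoint) (auto simp: P_def pairwise_def disjnt_def disjoint_def intro!: sum.cong)
      also have "\<dots> \<le> l * m" unfolding U(2)[symmetric] using \<S>(1) U(1) by (intro card_mono) auto
      finally have card: "card \<S> \<le> m" using l by simp
      have "(\<Sum>j\<in>\<Union>\<S>. (norm (x j))\<^sup>2) = (\<Sum>S\<in>\<S>. \<Sum>j\<in>S. (norm (x j))\<^sup>2)"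
        using \<S>(2) finS by (subst sum.Union_disjoint) (auto simp: pairwise_def disjnt_def)
      also have "\<dots> \<le> (\<Sum>S\<in>\<S>. 64 * (K + 1) * rad U S x)"
        using \<S>(1) by (intro sum_mono) (auto simp: P_def)
      also have "\<dots> = 64 * (K + 1) * (\<Sum>S\<in>\<S>. rad U S x)" by (simp add: sum_distrib_left)
      also have "\<dots> \<le> 64 * (K + 1) * (D * r)"
        unfolding r_def using K(2) \<S> fin card
        by (intro mult_left_mono sum_rad_family_le[OF cb D U(1)]) auto
      finally have packed: "(\<Sum>j\<in>\<Union>\<S>. (norm (x j))\<^sup>2) \<le> 64 * (K + 1) * D * r" by simp
      have "(\<Sum>j\<in>U - \<Union>\<S>. (norm (x j))\<^sup>2) \<le> 4 / 3 * real M * (sqrt r)\<^sup>2"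
      proof (rule sum_sq_le_of_dyadic_levels)
        fix t :: real assume t: "t > 0"
        let ?V = "{j \<in> U - \<Union>\<S>. t / 2 < norm (x j) \<and> norm (x j) \<le> t}"
        show "card ?V \<le> M"
        proof (rule ccontr)
          assume "\<not> card ?V \<le> M"
          then have "finite U \<and> ?V \<subseteq> U \<and> M \<le> card ?V \<and> t / 2 > 0 \<and> (\<forall>j\<in>?V. t / 2 \<le> norm (x j))"
            using U(1) t by auto
          with M obtain S where S: "S \<subseteq> ?V" "card S = l" "real l * (t / 2)\<^sup>2 / (16 * (K + 1)) \<le> rad U S x"
            by meson
          have "(\<Sum>j\<in>S. (norm (x j))\<^sup>2) \<le> real l * t\<^sup>2"
            using S sum_bounded_above[of S "\<lambda>j. (norm (x j))\<^sup>2" "t\<^sup>2"] by (force intro: power_mono)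
          also have "\<dots> = 64 * (K + 1) * (real l * (t / 2)\<^sup>2 / (16 * (K + 1)))"
          proof -
            have "K + 1 \<noteq> 0" using K(2) by simp
            then show ?thesis by (simp add: power_divide divide_simps)
          qed
          also have "\<dots> \<le> 64 * (K + 1) * rad U S x" using S(3) K(2) by (intro mult_left_mono) auto
          finally have "P S" using S(2) by (simp add: P_def)
          then show False using \<S>(3) S(1) by blast
        qed
      next
        fix j assume "j \<in> U - \<Union>\<S>"
        then show "norm (x j) \<le> sqrt r"
          using norm_sq_le_rad[OF U(1), of j x] by (intro real_le_rsqrt) (simp add: r_def)
      qed (use U in auto)
      also have "\<dots> \<le> 2 * real M * r" using r0 by (simp add: mult_right_mono)
      finally have rest: "(\<Sum>j\<in>U - \<Union>\<S>. (norm (x j))\<^sup>2) \<le> 2 * real M * r" .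
      have "\<Union>\<S> \<subseteq> U" using \<S>(1) by blast
      then have "(\<Sum>j\<in>U. (norm (x j))\<^sup>2) = (\<Sum>j\<in>U - \<Union>\<S>. (norm (x j))\<^sup>2) + (\<Sum>j\<in>\<Union>\<S>. (norm (x j))\<^sup>2)"
        by (rule sum.subset_diff) (rule U(1))
      then have "(\<Sum>j\<in>U. (norm (x j))\<^sup>2) \<le> (64 * (K + 1) * D + 2 * real M) * r"
        using packed rest by (simp add: distrib_right)
      then show "(\<Sum>j<l * m. (norm (x j))\<^sup>2) \<le>
          (64 * (K + 1) * D + 2 * real M) * (rademacher_mean (l * m) x)\<^sup>2"
        by (simp add: U_def r_def rademacher_mean_sq)
    qed
  qed
qed

lemma cotype2_bound_one: "cotype2_bound TYPE('a::real_normed_vector) 1 1"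
  unfolding cotype2_bound_def rademacher_mean_sq
proof
  fix y :: "nat \<Rightarrow> 'a"
  show "(\<Sum>b<1. (norm (y b))\<^sup>2) \<le> 1 * rad {..<1} {..<1} y"
    using norm_sq_le_rad[of "{..<1}" 0 y] by simp
qed

text \<open>Iterating the preceding inequality gives a bound of the order of \<open>C\<^sup>j\<close> at \<open>n = l\<^sup>j\<close>, that is,
  \<open>n\<close> to the power \<open>ln C / ln l\<close>, and this exponent tends to \<open>0\<close> as \<open>l\<close> grows.\<close>

lemma cotype2_bound_subpolynomial:
  assumes K: "orlicz_const TYPE('a::real_normed_vector) K" "K \<ge> 0" and b: "b > 0"
  shows "\<exists>A\<ge>0. \<forall>n\<ge>1. cotype2_bound TYPE('a) n (A * real n powr b)"
proof -
  define C where "C = 64 * (K + 1)"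
  have C: "C \<ge> 2" using K(2) by (simp add: C_def)
  obtain l :: nat where l: "real l \<ge> max 2 (C powr (1 / b))" using real_arch_simple by blast
  then have l2: "l \<ge> 2" by simp
  have "C = (C powr (1 / b)) powr b" using C b by (simp add: powr_powr)
  also have "\<dots> \<le> real l powr b" using l b by (intro powr_mono2) auto
  finally have Cl: "C \<le> real l powr b" .
  have "\<exists>M::nat. \<forall>m D. cotype2_bound TYPE('a) m D \<and> D \<ge> 0 \<longrightarrow>
     cotype2_bound TYPE('a) (l * m) (C * D + 2 * real M)"
    unfolding C_def using l2 by (intro cotype2_bound_times[OF K]) simp
  then obtain M :: nat where M: "\<forall>m D. cotype2_bound TYPE('a) m D \<and> D \<ge> 0 \<longrightarrow>
     cotype2_bound TYPE('a) (l * m) (C * D + 2 * real M)"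
    by (rule exE)
  \<comment> \<open>chosen so that \<open>D j + 2 M\<close> grows exactly by the factor \<open>C\<close>; the inequality \<open>C \<ge> 2\<close> absorbs the additive term\<close>
  define D where "D j = (1 + 2 * real M) * C ^ j - 2 * real M" for j :: nat
  have Cj: "C ^ j \<ge> 1" for j using C by (intro one_le_power) simp
  have D0: "D j \<ge> 0" for j
  proof -
    have "2 * real M \<le> (1 + 2 * real M) * 1" by simp
    also have "\<dots> \<le> (1 + 2 * real M) * C ^ j" using Cj by (intro mult_left_mono) auto
    finally show ?thesis by (simp only: D_def diff_ge_0_iff_ge)
  qed
  have pow: "cotype2_bound TYPE('a) (l ^ j) (D j)" for j
  proof (induction j)
    case 0
    then show ?case using cotype2_bound_one by (simp add: D_def)
  next
    case (Suc j)
    have "2 * (2 * real M) \<le> C * (2 * real M)" using C by (intro mult_right_mono) auto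
    then have "C * D j + 2 * real M \<le> D (Suc j)" by (simp add: D_def algebra_simps)
    moreover have "0 \<le> C * D j + 2 * real M" using C D0[of j] by simp
    ultimately have "cotype2_bound TYPE('a) (l * l ^ j) (D (Suc j))"
      by (intro cotype2_bound_mono[OF M[rule_format, OF conjI[OF Suc D0]]]) simp_all
    then show ?case by simp
  qed
  show ?thesis
  proof (intro exI[of _ "(1 + 2 * real M) * C"] conjI allI impI)
    show "0 \<le> (1 + 2 * real M) * C" using C by simp
    fix n :: nat assume n: "n \<ge> 1"
    have "n < 2 ^ n" by (rule less_exp)
    also have "(2::nat) ^ n \<le> l ^ n" using l2 by (intro power_mono) auto
    finally have ex: "n \<le> l ^ n" by simp
    define j where "j = (LEAST j. n \<le> l ^ j)"
    have j: "n \<le> l ^ j" unfolding j_def using ex by (rule LeastI)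
    have Cn: "C ^ j \<le> C * real n powr b"
    proof (cases j)
      case 0
      have "1 * 1 \<le> C * real n powr b" using C n b by (intro mult_mono ge_one_powr_ge_zero) auto
      then show ?thesis using 0 by simp
    next
      case (Suc i)
      have "\<not> n \<le> l ^ i" using Suc not_less_Least[of i "\<lambda>j. n \<le> l ^ j"] by (simp add: j_def)
      then have "real (l ^ i) \<le> real n" by simp
      have "C ^ i \<le> (real l powr b) ^ i" using Cl C by (intro power_mono) auto
      also have "\<dots> = real (l ^ i) powr b"
        using l2 by (simp add: powr_power powr_powr mult.commute flip: powr_realpow)
      also have "\<dots> \<le> real n powr b" using \<open>real (l ^ i) \<le> real n\<close> b by (intro powr_mono2) auto
      finally show ?thesis using C Suc by simp
    qed
    have "D j \<le> (1 + 2 * real M) * C ^ j" by (simp add: D_def)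
    also have "\<dots> \<le> (1 + 2 * real M) * (C * real n powr b)" using Cn by (intro mult_left_mono) auto
    finally show "cotype2_bound TYPE('a) n ((1 + 2 * real M) * C * real n powr b)"
      using j D0 by (intro cotype2_bound_mono[OF pow[of j]]) (auto simp: mult.assoc)
  qed
qed

section \<open>Cotype\<close>

text \<open>The smallest of \<open>k\<close> numbers is controlled by their quadratic mean.  Remove it and repeat.\<close>

lemma sum_powr_le_of_subset_sums:
  fixes a :: "'i \<Rightarrow> real"
  assumes "finite S" and nn: "\<And>j. a j \<ge> 0" and B: "B \<ge> 0" and q: "q > 0"
    and "\<And>T. T \<subseteq> S \<Longrightarrow> T \<noteq> {} \<Longrightarrow> (\<Sum>j\<in>T. (a j)\<^sup>2) \<le> B * real (card T) powr b"
  shows "(\<Sum>j\<in>S. a j powr q) \<le> B powr (q / 2) * (\<Sum>k<card S. real (Suc k) powr ((b - 1) * (q / 2)))"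
  using assms(1,5)
proof (induction S rule: finite_psubset_induct)
  case (psubset S)
  show ?case
  proof (cases "S = {}")
    case False
    define m where "m = Min (a ` S)"
    have le_m: "m \<le> a j" if "j \<in> S" for j using that psubset.hyps by (simp add: m_def)
    have "m \<in> a ` S" unfolding m_def using False psubset.hyps by (intro Min_in) auto
    then obtain t where t: "t \<in> S" "a t = m" by blast
    have m0: "m \<ge> 0" using nn[of t] t by simp
    obtain k where k: "card S = Suc k" using t psubset.hyps by (cases "card S") auto
    have "real (card S) * m\<^sup>2 \<le> (\<Sum>j\<in>S. (a j)\<^sup>2)"
      using le_m m0 by (intro sum_bounded_below power_mono) auto
    also have "\<dots> \<le> B * real (card S) powr b" using False by (intro psubset.prems) auto
    finally have "m\<^sup>2 \<le> B * (real (card S) powr b / real (card S))"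
      using k by (simp add: field_simps)
    also have "\<dots> = B * real (card S) powr (b - 1)" using k by (simp add: powr_diff)
    finally have "(m\<^sup>2) powr (q / 2) \<le> (B * real (card S) powr (b - 1)) powr (q / 2)"
      using q by (intro powr_mono2) auto
    moreover have "(m\<^sup>2) powr (q / 2) = m powr q"
    proof (cases "m = 0")
      case False
      then have "m\<^sup>2 = m powr 2" using m0 by (simp add: powr_numeral)
      then show ?thesis by (simp add: powr_powr)
    qed simp
    ultimately have small: "a t powr q \<le> B powr (q / 2) * real (Suc k) powr ((b - 1) * (q / 2))"
      using B t k by (simp add: powr_mult powr_powr)
    have "(\<Sum>j\<in>S - {t}. a j powr q) \<le>
        B powr (q / 2) * (\<Sum>k<card (S - {t}). real (Suc k) powr ((b - 1) * (q / 2)))"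
      using t by (intro psubset.IH psubset.prems) auto
    moreover have "(\<Sum>j\<in>S. a j powr q) = a t powr q + (\<Sum>j\<in>S - {t}. a j powr q)"
      using psubset.hyps t by (intro sum.remove) auto
    ultimately show ?thesis using small t k psubset.hyps by (simp add: distrib_left)
  qed simp
qed

text \<open>With \<open>b = (1 - 2/q) / 2\<close> the series of the terms \<open>k\<^bsup>(b - 1) q / 2\<^esup>\<close> converges, since its exponent is
  \<open>- (q/4 + 1/2) < -1\<close>.\<close>

lemma orlicz_imp_has_cotype:
  assumes K: "orlicz_const TYPE('a::real_normed_vector) K" "K \<ge> 0" and q: "q > 2"
  shows "has_cotype (ereal q) TYPE('a)"
proof -
  define b where "b = (1 - 2 / q) / 2"
  have b: "b > 0" using q by (simp add: b_def)
  have exponent: "(b - 1) * (q / 2) < - 1" using q by (simp add: b_def field_simps)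
  obtain A where A: "A \<ge> 0" and bound: "\<forall>n\<ge>1. cotype2_bound TYPE('a) n (A * real n powr b)"
    using cotype2_bound_subpolynomial[OF K b] by blast
  let ?g = "\<lambda>k. real (Suc k) powr ((b - 1) * (q / 2))"
  have "summable (\<lambda>k. real k powr ((b - 1) * (q / 2)))"
    using exponent by (simp add: summable_real_powr_iff)
  then have sg: "summable ?g" by (subst summable_Suc_iff)
  define Z where "Z = (\<Sum>k. ?g k)"
  have Z0: "Z \<ge> 0" unfolding Z_def by (intro suminf_nonneg sg) simp
  show ?thesis
    unfolding has_cotype_def
  proof (intro exI[of _ "sqrt A * Z powr (1 / q)"] conjI allI)
    show "0 \<le> sqrt A * Z powr (1 / q)" using A by simp
    fix n and x :: "nat \<Rightarrow> 'a"
    let ?R = "rademacher_mean n x"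
    have "(\<Sum>j<n. norm (x j) powr q) \<le> (A * ?R\<^sup>2) powr (q / 2) * (\<Sum>k<card {..<n}. ?g k)"
    proof (rule sum_powr_le_of_subset_sums)
      fix T assume T: "T \<subseteq> {..<n}" "T \<noteq> {}"
      then have "finite T" using finite_subset by blast
      then have "card T \<ge> 1" using T by (simp add: Suc_le_eq card_gt_0_iff)
      then have "(\<Sum>j\<in>T. (norm (x j))\<^sup>2) \<le> A * real (card T) powr b * rad {..<n} {..<n} x"
        using A T bound by (intro sum_norm_sq_subset_le[where m = "card T"]) auto
      then show "(\<Sum>j\<in>T. (norm (x j))\<^sup>2) \<le> A * ?R\<^sup>2 * real (card T) powr b"
        by (simp add: rademacher_mean_sq mult_ac)
    qed (use A q in auto)
    also have "\<dots> \<le> (A * ?R\<^sup>2) powr (q / 2) * Z"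
      unfolding Z_def using sg by (intro mult_left_mono sum_le_suminf) auto
    finally have "(\<Sum>j<n. norm (x j) powr q) powr (1 / q) \<le> ((A * ?R\<^sup>2) powr (q / 2) * Z) powr (1 / q)"
      using q by (intro powr_mono2) (auto simp: sum_nonneg)
    also have "\<dots> = (A * ?R\<^sup>2) powr (1 / 2) * Z powr (1 / q)"
      using A Z0 q by (simp add: powr_mult powr_powr)
    also have "(A * ?R\<^sup>2) powr (1 / 2) = sqrt A * ?R"
      using A rademacher_mean_nonneg[of n x] by (simp add: powr_half_sqrt real_sqrt_mult)
    finally show "if ereal q = \<infinity> then \<forall>j<n. norm (x j) \<le> sqrt A * Z powr (1 / q) * ?R
        else (\<Sum>j<n. norm (x j) powr real_of_ereal (ereal q)) powr (1 / real_of_ereal (ereal q))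
               \<le> sqrt A * Z powr (1 / q) * ?R"
      by (simp add: mult_ac)
  qed
qed

lemma orlicz_imp_cotype_index:
  assumes "orlicz_const TYPE('a::real_normed_vector) K" "K \<ge> 0"
  shows "cotype_index TYPE('a) = 2"
proof (rule antisym)
  show "cotype_index TYPE('a) \<le> 2"
  proof (rule ereal_le_epsilon2)
    fix e :: real assume e: "0 < e"
    have "has_cotype (ereal (2 + e)) TYPE('a)" using orlicz_imp_has_cotype[OF assms] e by simp
    then have "cotype_index TYPE('a) \<le> ereal (2 + e)"
      unfolding cotype_index_def using e by (intro Inf_lower) simp
    then show "cotype_index TYPE('a) \<le> 2 + ereal e" by simp
  qed
  show "2 \<le> cotype_index TYPE('a)" unfolding cotype_index_def by (intro Inf_greatest) simp
qed

section \<open>The cotype index\<close>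

theorem proposition2p4:
  fixes scaleC :: "complex \<Rightarrow> 'a::banach \<Rightarrow> 'a"
  shows "(dominated_forms (scaleR :: real \<Rightarrow> 'a \<Rightarrow> 'a) 1 = cont_bilinear_forms scaleR \<longrightarrow>
            cotype_index TYPE('a) = 2) \<and>
         (normed_scaling scaleC \<longrightarrow>
            dominated_forms scaleC 1 = cont_bilinear_forms scaleC \<longrightarrow>
            cotype_index TYPE('a) = 2)"
proof (intro conjI impI)
  assume dom: "dominated_forms (scaleR :: real \<Rightarrow> 'a \<Rightarrow> 'a) 1 = cont_bilinear_forms scaleR"
  have "\<exists>K\<ge>0. orlicz_const TYPE('a) K"
  proof (rule dominated_imp_orlicz[OF normed_scaling_scaleR dom real_norming_dual_ball])
    fix \<phi> :: "'a \<Rightarrow> real" and n and u :: "nat \<Rightarrow> 'a" and w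
    assume \<phi>: "\<phi> \<in> dual_ball scaleR"
      and u: "\<forall>\<epsilon>\<in>{..<n} \<rightarrow>\<^sub>E {-1, 1}. norm (\<Sum>i<n. \<epsilon> i *\<^sub>R u i) \<le> w"
    have "(\<Sum>i<n. \<bar>\<phi> (u i)\<bar>) \<le> w"
      by (rule sum_abs_functional_le[OF _ _ u]) (use dual_ballD[OF \<phi>] in \<open>auto intro: linearI\<close>)
    moreover have "(\<Sum>i<n. \<bar>\<phi> (u i)\<bar>) \<ge> 0" by (intro sum_nonneg) auto
    ultimately show "(\<Sum>i<n. norm (\<phi> (u i))) \<le> 2 * w" unfolding real_norm_def by linarith
  qed
  then show "cotype_index TYPE('a) = 2" using orlicz_imp_cotype_index by blast
next
  assume smul: "normed_scaling scaleC"
    and dom: "dominated_forms scaleC 1 = cont_bilinear_forms scaleC"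
  have "\<exists>K\<ge>0. orlicz_const TYPE('a) K"
  proof (rule dominated_imp_orlicz[OF smul dom complex_norming_dual_ball[OF smul]])
    fix \<phi> :: "'a \<Rightarrow> complex" and n and u :: "nat \<Rightarrow> 'a" and w
    assume \<phi>: "\<phi> \<in> dual_ball scaleC"
      and u: "\<forall>\<epsilon>\<in>{..<n} \<rightarrow>\<^sub>E {-1, 1}. norm (\<Sum>i<n. \<epsilon> i *\<^sub>R u i) \<le> w"
    note \<phi>l = dual_ballD[OF \<phi>]
    have "(\<Sum>i<n. \<bar>Re (\<phi> (u i))\<bar>) \<le> w"
      by (rule sum_abs_functional_le[OF _ _ u])
        (use \<phi>l order_trans[OF abs_Re_le_cmod] in \<open>auto intro: linearI\<close>)
    moreover have "(\<Sum>i<n. \<bar>Im (\<phi> (u i))\<bar>) \<le> w"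
      by (rule sum_abs_functional_le[OF _ _ u])
        (use \<phi>l order_trans[OF abs_Im_le_cmod] in \<open>auto intro: linearI\<close>)
    moreover have "(\<Sum>i<n. norm (\<phi> (u i))) \<le> (\<Sum>i<n. \<bar>Re (\<phi> (u i))\<bar> + \<bar>Im (\<phi> (u i))\<bar>)"
      by (intro sum_mono cmod_le)
    ultimately show "(\<Sum>i<n. norm (\<phi> (u i))) \<le> 2 * w" by (simp add: sum.distrib)
  qed
  then show "cotype_index TYPE('a) = 2" using orlicz_imp_cotype_index by blast
qed

end
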